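(* Consider the distributed online problem, network and algorithm described in the context. Suppose: (1) $\mathbb{X}\subseteq\mathbb{R}^p$ is convex and closed, and $\|x\|\le R(\mathbb{X})$ for all $x\in\mathbb{X}$. (2) For all $i\in[n]$, $t\in\mathbb{N}_+$ and $x\in\mathbb{X}$, the subgradients $\nabla f_{i,t}(x)$ and $\nabla g_{i,t}(x)$ exist, and there are constants $G_1,G_2$ with $\|\nabla f_{i,t}(x)\|\le G_1$ and $\|\nabla g_{i,t}(x)\|\le G_2$ for all such $i,t,x$. (3) There is a constant $L$ such that $\|\nabla f_{i,t}(x)-\nabla f_{i,t}(y)\|\le L\|x-y\|$ for all $x,y\in\mathbb{X}$, $i\in[n]$, $t\in\mathbb{N}_+$. (4) For all $t\in\mathbb{N}_+$: (i) there is a constant $w\in(0,1)$ (independent of $t$) such that $[W_t]_{ij}\ge w$ if $(j,i)\in\mathcal{E}_t$ or $i=j$, and $[W_t]_{ij}=0$ otherwise; (ii) $W_t$ is doubly stochastic; (iii) there is an integer $B>0$ (independent of $t$) such that the directed graph $(\mathcal{V},\cup_{l=0}^{B-1}\mathcal{E}_{t+l})$ is strongly connected. (5) The (possibly random) compressor $\mathcal{C}:\mathbb{R}^p\to\mathbb{R}^p$ satisfies $\mathbf{E}_{\mathcal{C}}[\|\mathcal{C}(x)-x\|_d^2]\le C$ for all $x\in\mathbb{R}^p$, for some norm parameter $d\ge1$ and constant $C\ge0$. Let $\{x_{i,t}\}$ be the sequences generated by the algorithm with $$\alpha_t=\frac{\alpha_0}{t^{\theta_1}},\qquad \gamma_t=\frac{\gamma_0}{\alpha_t},\qquad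 s_t=\frac{s_0}{t^{\theta_2}},$$ where $\theta_1\in(0,1)$, $\alpha_0>0$, $\gamma_0\in(0,1/(4G_2^2)]$, $s_0>0$ and $\theta_2>\theta_1$ are constants. Then, for any $T\in\mathbb{N}_+$, $$\mathbf{E}_{\mathcal{C}}[\mathrm{Net\text{-}Reg}(T)]=\begin{cases}\mathcal{O}\big(T^{\max\{1-\theta_1,\,1+\theta_1-\theta_2\}}\big), & \text{if }\theta_1<\theta_2<1,\\ \mathcal{O}\big(T^{\max\{1-\theta_1,\,\theta_1\}}\big), & \text{if }\theta_2\ge1,\end{cases}$$ $$\mathbf{E}_{\mathcal{C}}[\mathrm{Net\text{-}CCV}(T)]=\mathcal{O}\big(T^{1-\theta_1/2}\big).$$ Moreover, if in addition Slater's condition holds, i.e., there exist a point $x_s\in\mathbb{X}$ and a constant $\varsigma_s>0$ such that $g_t(x_s)\le-\varsigma_s\mathbf{1}_m$ for all $t\in\mathbb{N}_+$, then $$\mathbf{E}_{\mathcal{C}}[\mathrm{Net\text{-}CCV}(T)]=\mathcal{O}\big(T^{1-\theta_1}\big).$$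
   Context: Notation. $[n]=\{1,\dots,n\}$. Vector inequalities are componentwise. $\|\cdot\|$ is the Euclidean norm (induced operator norm for matrices), $\|\cdot\|_d$ is the $\ell_d$ norm. $\mathbf{1}_m,\mathbf{0}_m$ are the all-ones and all-zeros vectors in $\mathbb{R}^m$. $\mathcal{P}_{\mathbb{X}}$ is Euclidean projection onto $\mathbb{X}$, and $[x]_+$ is the projection onto the nonnegative orthant (componentwise positive part). $\nabla f(x)$ denotes the subgradient of $f$ at $x$; for the convex vector-valued $g_{i,t}$, $\nabla g_{i,t}(x)\in\mathbb{R}^{m_i\times p}$ is a matrix whose rows are subgradients of the components, so $g_{i,t}(y)\ge g_{i,t}(x)+\nabla g_{i,t}(x)(y-x)$ for $x,y\in\mathbb{X}$. $\mathcal{O}(\cdot)$ is with respect to $T$, with constants independent of $T$. Network. At iteration $t\in\mathbb{N}_+$, $n$ agents communicate over a directed graph $\mathcal{G}_t=(\mathcal{V},\mathcal{E}_t)$, $\mathcal{V}=[n]$, $\mathcal{E}_t\subseteq\mathcal{V}\times\mathcal{V}$; $(j,i)\in\mathcal{E}_t$ means agent $i$ can receive information from agent $j$. $W_t\in\mathbb{R}^{n\times n}$ is the mixing matrix associated with $\mathcal{G}_t$. Problem. $f_{i,t}:\mathbb{X}\to\mathbb{R}$ are (possibly nonconvex) local loss functions and $g_{i,t}:\mathbb{X}\to\mathbb{R}^{m_i}$ are convex (componentwise) local constraint functions. $f_t(x)=\frac1n\sum_{j=1}^nf_{j,t}(x)$ (with $\nabla f_t=\frac1n\sum_j\nabla f_{j,t}$),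 $g_t(x)=\mathrm{col}(g_{1,t}(x),\dots,g_{n,t}(x))\in\mathbb{R}^m$ (concatenation), $m=\sum_im_i$. The feasible set $\mathcal{X}_T=\{x\in\mathbb{X}:g_t(x)\le\mathbf{0}_m,\ \forall t\in[T]\}$ is assumed nonempty for all $T\in\mathbb{N}_+$. Performance metrics. $$\mathrm{Net\text{-}Reg}(T)=\frac1n\sum_{i=1}^n\Big(\sum_{t=1}^T\langle\nabla f_t(x_{i,t}),x_{i,t}\rangle-\inf_{x\in\mathcal{X}_T}\Big\langle\sum_{t=1}^T\nabla f_t(x_{i,t}),x\Big\rangle\Big),$$ $$\mathrm{Net\text{-}CCV}(T)=\frac1n\sum_{i=1}^n\sum_{t=1}^T\|[g_t(x_{i,t})]_+\|.$$ Algorithm (distributed online primal–dual algorithm with compressed communication). Inputs: positive sequences $\{\alpha_t\}$ (stepsize, non-increasing), $\{s_t\}$ (scaling, non-increasing), $\{\gamma_t\}$ (regularization, non-decreasing). Initialize $\hat z_{j,0}=\mathbf{0}_p$ and $z_{i,1}\in\mathbb{X}$ for all $i,j\in[n]$. For $t=1,2,\dots$ and every $i,j\in[n]$: $$\hat z_{j,t}=\mathcal{P}_{\mathbb{X}}\big(\hat z_{j,t-1}+s_t\,\mathcal{C}((z_{j,t}-\hat z_{j,t-1})/s_t)\big),\qquad x_{i,t}=\sum_{j=1}^n[W_t]_{ij}\hat z_{j,t},$$ $$v_{i,t+1}=\gamma_t[g_{i,t}(x_{i,t})]_+,\qquad \omega_{i,t+1}=\nabla f_{i,t}(x_{i,t})+(\nabla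 g_{i,t}(x_{i,t}))^Tv_{i,t+1},\qquad z_{i,t+1}=\mathcal{P}_{\mathbb{X}}(x_{i,t}-\alpha_t\omega_{i,t+1}).$$ For each $j$ and $t$ the compressed vector is one realization broadcast by agent $j$, so $\hat z_{j,t}$ is common to all agents. $\mathbf{E}_{\mathcal{C}}$ is expectation over the internal randomness of the compressor; each call of the compressor uses fresh randomness independent of the past. *)

theory Defs
  imports "HOL-Probability.Probability"
begin

text \<open>
  Agents are the elements of a finite type \<open>'n\<close> and decisions live in \<open>real ^ 'p\<close>.  The
  number \<open>m i\<close> of local constraints depends on the agent, so a vector in
  $R^{m_i}$ is a function \<open>nat \<Rightarrow> real\<close> of which only the entries \<open>k < m i\<close> matter, and an
  $m_i \times p$ matrix is a function \<open>nat \<Rightarrow> real ^ 'p\<close> giving its rows.  Time indices are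
  positive natural numbers, except for the initial value at time 0 of the compressed variable.
\<close>

definition lp_norm :: "real \<Rightarrow> real ^ 'p \<Rightarrow> real" where
  "lp_norm d x = (\<Sum>i\<in>UNIV. \<bar>x $ i\<bar> powr d) powr (1 / d)"

text \<open>The same formula as \<^const>\<open>onorm\<close>, for a matrix with the rows \<open>A 0, \<dots>, A (r - 1)\<close>.\<close>

definition row_onorm :: "nat \<Rightarrow> (nat \<Rightarrow> real ^ 'p) \<Rightarrow> real" where
  "row_onorm r A = (SUP u. L2_set (\<lambda>k. A k \<bullet> u) {..<r} / norm u)"

text \<open>
  The global subgradient inequality is the notion for convex functions.  The loss functions need
  not be convex; for them we take the Frechet (regular) subgradient relative to the domain, which
  contains both the gradient of a differentiable function and the subgradients of a convex one.
\<close>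

definition subgradient_on ::
    "(real ^ 'p) set \<Rightarrow> (real ^ 'p \<Rightarrow> real) \<Rightarrow> real ^ 'p \<Rightarrow> real ^ 'p \<Rightarrow> bool" where
  "subgradient_on X f x u \<longleftrightarrow> (\<forall>y\<in>X. f y \<ge> f x + u \<bullet> (y - x))"

definition frechet_subgradient_on ::
    "(real ^ 'p) set \<Rightarrow> (real ^ 'p \<Rightarrow> real) \<Rightarrow> real ^ 'p \<Rightarrow> real ^ 'p \<Rightarrow> bool" where
  "frechet_subgradient_on X f x u \<longleftrightarrow>
     (\<forall>\<epsilon>>0. \<forall>\<^sub>F y in at x within X. f y \<ge> f x + u \<bullet> (y - x) - \<epsilon> * norm (y - x))"

definition doubly_stochastic :: "real ^ 'n ^ 'n \<Rightarrow> bool" where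
  "doubly_stochastic A \<longleftrightarrow>
     (\<forall>i j. 0 \<le> A $ i $ j) \<and> (\<forall>i. (\<Sum>j\<in>UNIV. A $ i $ j) = 1) \<and> (\<forall>j. (\<Sum>i\<in>UNIV. A $ i $ j) = 1)"

definition strongly_connected :: "('n \<times> 'n) set \<Rightarrow> bool" where
  "strongly_connected E \<longleftrightarrow> (\<forall>i j. (i, j) \<in> E\<^sup>*)"

definition feasible_set ::
    "(real ^ 'p) set \<Rightarrow> ('n \<Rightarrow> nat) \<Rightarrow> ('n \<Rightarrow> nat \<Rightarrow> real ^ 'p \<Rightarrow> nat \<Rightarrow> real) \<Rightarrow> nat
       \<Rightarrow> (real ^ 'p) set" where
  "feasible_set X m g T = {x \<in> X. \<forall>t\<in>{1..T}. \<forall>i. \<forall>k<m i. g i t x k \<le> 0}"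

definition slater ::
    "(real ^ 'p) set \<Rightarrow> ('n \<Rightarrow> nat) \<Rightarrow> ('n \<Rightarrow> nat \<Rightarrow> real ^ 'p \<Rightarrow> nat \<Rightarrow> real) \<Rightarrow> bool" where
  "slater X m g \<longleftrightarrow> (\<exists>xs\<in>X. \<exists>\<zeta>>0. \<forall>t\<ge>1. \<forall>i. \<forall>k<m i. g i t xs k \<le> - \<zeta>)"

text \<open>
  One realization of the algorithm.  \<open>Comp j t\<close> is the realization of the compressor that agent
  \<open>j\<close> applies at time \<open>t\<close>; the arguments from \<open>zh\<close> on are the trajectories of
  $\hat z$, $z$, $x$, $v$ and $\omega$.
\<close>

definition algorithm_run ::
    "(real ^ 'p) set \<Rightarrow> ('n::finite \<Rightarrow> nat)
       \<Rightarrow> ('n \<Rightarrow> nat \<Rightarrow> real ^ 'p \<Rightarrow> real ^ 'p)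
       \<Rightarrow> ('n \<Rightarrow> nat \<Rightarrow> real ^ 'p \<Rightarrow> nat \<Rightarrow> real)
       \<Rightarrow> ('n \<Rightarrow> nat \<Rightarrow> real ^ 'p \<Rightarrow> nat \<Rightarrow> real ^ 'p)
       \<Rightarrow> (nat \<Rightarrow> real ^ 'n ^ 'n)
       \<Rightarrow> (nat \<Rightarrow> real) \<Rightarrow> (nat \<Rightarrow> real) \<Rightarrow> (nat \<Rightarrow> real)
       \<Rightarrow> ('n \<Rightarrow> real ^ 'p)
       \<Rightarrow> ('n \<Rightarrow> nat \<Rightarrow> real ^ 'p \<Rightarrow> real ^ 'p)
       \<Rightarrow> ('n \<Rightarrow> nat \<Rightarrow> real ^ 'p) \<Rightarrow> ('n \<Rightarrow> nat \<Rightarrow> real ^ 'p) \<Rightarrow> ('n \<Rightarrow> nat \<Rightarrow> real ^ 'p)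
       \<Rightarrow> ('n \<Rightarrow> nat \<Rightarrow> nat \<Rightarrow> real) \<Rightarrow> ('n \<Rightarrow> nat \<Rightarrow> real ^ 'p) \<Rightarrow> bool" where
  "algorithm_run X m df g dg W \<alpha> \<gamma> s z1 Comp zh z x v om \<longleftrightarrow>
     (\<forall>j. zh j 0 = 0) \<and> (\<forall>i. z i 1 = z1 i) \<and>
     (\<forall>t\<ge>1. \<forall>i.
        zh i t = closest_point X (zh i (t - 1) + s t *\<^sub>R Comp i t ((z i t - zh i (t - 1)) /\<^sub>R s t)) \<and>
        x i t = (\<Sum>j\<in>UNIV. W t $ i $ j *\<^sub>R zh j t) \<and>
        (\<forall>k<m i. v i (t + 1) k = \<gamma> t * max 0 (g i t (x i t) k)) \<and>
        om i (t + 1) = df i t (x i t) + (\<Sum>k<m i. v i (t + 1) k *\<^sub>R dg i t (x i t) k) \<and>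
        z i (t + 1) = closest_point X (x i t - \<alpha> t *\<^sub>R om i (t + 1)))"

definition avg_grad ::
    "('n::finite \<Rightarrow> nat \<Rightarrow> real ^ 'p \<Rightarrow> real ^ 'p) \<Rightarrow> nat \<Rightarrow> real ^ 'p \<Rightarrow> real ^ 'p" where
  "avg_grad df t x = (1 / real CARD('n)) *\<^sub>R (\<Sum>j\<in>UNIV. df j t x)"

definition net_reg ::
    "(real ^ 'p) set \<Rightarrow> ('n::finite \<Rightarrow> nat)
       \<Rightarrow> ('n \<Rightarrow> nat \<Rightarrow> real ^ 'p \<Rightarrow> real ^ 'p)
       \<Rightarrow> ('n \<Rightarrow> nat \<Rightarrow> real ^ 'p \<Rightarrow> nat \<Rightarrow> real)
       \<Rightarrow> ('n \<Rightarrow> nat \<Rightarrow> real ^ 'p) \<Rightarrow> nat \<Rightarrow> real" where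
  "net_reg X m df g x T =
     (1 / real CARD('n)) *
       (\<Sum>i\<in>UNIV. (\<Sum>t=1..T. avg_grad df t (x i t) \<bullet> x i t)
          - (INF y\<in>feasible_set X m g T. (\<Sum>t=1..T. avg_grad df t (x i t)) \<bullet> y))"

text \<open>The stacked vector $g_t$ is indexed by the pairs \<open>(j, k)\<close> with \<open>k < m j\<close>.\<close>

definition net_ccv ::
    "('n::finite \<Rightarrow> nat) \<Rightarrow> ('n \<Rightarrow> nat \<Rightarrow> real ^ 'p \<Rightarrow> nat \<Rightarrow> real)
       \<Rightarrow> ('n \<Rightarrow> nat \<Rightarrow> real ^ 'p) \<Rightarrow> nat \<Rightarrow> real" where
  "net_ccv m g x T =
     (1 / real CARD('n)) *
       (\<Sum>i\<in>UNIV. \<Sum>t=1..T.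
          L2_set (\<lambda>(j, k). max 0 (g j t (x i t) k)) (SIGMA j:UNIV. {..<m j}))"

text \<open>
  The expectation of \<open>Y T\<close> exists and is at most a constant times \<open>h T\<close>, for all \<open>T \<ge> 1\<close>.  The
  bound is one-sided, as usual for regret: the regret compares with feasible points only and can
  be very negative when the iterates are infeasible.  For nonnegative \<open>Y\<close> this is the ordinary
  big-O.  Integrability is demanded because the Bochner integral of a non-integrable function is 0.
\<close>

definition expectation_bigo ::
    "'w measure \<Rightarrow> (nat \<Rightarrow> 'w \<Rightarrow> real) \<Rightarrow> (nat \<Rightarrow> real) \<Rightarrow> bool" where
  "expectation_bigo M Y h \<longleftrightarrow>
     (\<exists>K. \<forall>T\<ge>1. integrable M (Y T) \<and> integral\<^sup>L M (Y T) \<le> K * h T)"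

text \<open>
  A random compressor is a map \<open>Comp u r\<close>, where \<open>r\<close> is drawn from the law \<open>Q\<close> of its internal
  randomness.  \<open>\<xi> j t\<close> is the randomness used by agent \<open>j\<close> at time \<open>t\<close>.  It is independent of
  everything drawn before time \<open>t\<close>; nothing is required about different agents at the same time.
  The independence is that of the generated sigma-algebras, because the library's \<open>indep_var\<close> needs
  both variables to have values in the same type.
\<close>

definition fresh_randomness ::
    "'w measure \<Rightarrow> 'r measure \<Rightarrow> ('n \<Rightarrow> nat \<Rightarrow> 'w \<Rightarrow> 'r) \<Rightarrow> bool" where
  "fresh_randomness M Q \<xi> \<longleftrightarrow>
     (\<forall>t\<ge>1. \<forall>j. \<xi> j t \<in> measurable M Q \<and> distr M Q (\<xi> j t) = Q \<and>
        prob_space.indep_set M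
          {\<xi> j t -` A \<inter> space M | A. A \<in> sets Q}
          {(\<lambda>\<omega>. \<lambda>(i, l)\<in>UNIV \<times> {1..<t}. \<xi> i l \<omega>) -` A \<inter> space M | A.
             A \<in> sets (PiM (UNIV \<times> {1..<t}) (\<lambda>_. Q))})"

end

theory Submission
  imports Defs
begin

text \<open>
  Write $b_{i,t}$ for the norm of $[g_{i,t}(x_{i,t})]_+$ and $e_{j,t}$ for the compression error, so
  that $\|\hat z_{j,t} - z_{j,t}\| \le s_t e_{j,t}$.  Since $\alpha_t \gamma_t = \gamma_0$, one
  projected step taken against a feasible comparator $y$ gives
  $$2 \alpha_t \sum_i \langle \nabla f_{i,t}(x_{i,t}), x_{i,t} - y \rangle
    + \frac{3}{2} \gamma_0 \sum_i b_{i,t}^2 \le V_t - V_{t+1}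
    + 4 R s_t \sum_j e_{j,t} + 2 n G_1^2 \alpha_t^2,
    \qquad V_t = \sum_i \|z_{i,t} - y\|^2.$$
  The products of $n B$ successive mixing matrices have entries at least $w^{n B}$, so the
  disagreement among the agents contracts and its sum over time is bounded by the sum of the
  perturbations $s_t e_{j,t} + G_1 \alpha_t + G_2 \gamma_0 b_{i,t}$.  For the regret the inequality
  is divided by $2 \alpha_t$, and the term $b_{i,t}$ coming from the disagreement is absorbed into
  $\gamma_0 b_{i,t}^2 / \alpha_t$ by Young's inequality.  For the constraint violation the sum of the
  $b_{i,t}^2$ is bounded first; with a Slater point as comparator a term linear in $b_{i,t}$ appears on
  the left.  All bounds hold for every realization and are affine in the $e_{j,t}$, so
  only $E[e_{j,t}] \le 1 + E[e_{j,t}^2]$ is needed, which is finite because the input of the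
  compressor is a function of the past.
\<close>

section \<open>Norms and power sums\<close>

text \<open>Because \<open>\<alpha> t * \<gamma> t\<close> is the constant \<open>\<gamma>0\<close>,
  the constraint part of a step is proportional to the violation and does not decay. The
  disagreement therefore has no vanishing bound round by round: it is controlled only in sum,
  through the violations, which must be paid for by the quadratic term of the descent inequality.
  The bound on \<open>\<gamma>0\<close> keeps that term alive: convexity supplies
  \<open>2 * \<gamma>0\<close> times the squared violation, and the squared step length takes back
  at most a quarter of it. Boundedness of X lets the compression errors enter linearly: a difference
  of squared distances is a difference of distances times at most \<open>4 * R\<close>. Young's
  inequality with a free weight, rather than Cauchy-Schwarz, keeps the bounds affine, so
  expectations can be taken term by term. The trajectories are only assumed to obey the recursion
  outcome by outcome; their measurability, and the adaptedness that separates each compressor input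
  from its fresh draw, are proved by induction on time. Dividing by \<open>\<alpha> t\<close> turns
  the error weights into multiples of t^(\<theta>2 - \<theta>1) inverted, whose sum is the source of
  the exponent 1 + \<theta>1 - \<theta>2.\<close>

lemma norm_le_lp_norm:
  fixes x :: "real ^ 'p"
  assumes "d \<ge> 1"
  shows "norm x \<le> real CARD('p) * lp_norm d x"
proof -
  have "\<bar>x $ i\<bar> \<le> lp_norm d x" for i
  proof -
    have "\<bar>x $ i\<bar> = (\<bar>x $ i\<bar> powr d) powr (1 / d)"
      using assms by (simp add: powr_powr)
    also have "\<dots> \<le> lp_norm d x"
      unfolding lp_norm_def using assms by (intro powr_mono2 member_le_sum) auto
    finally show ?thesis .
  qed
  then have "(\<Sum>i\<in>UNIV. \<bar>x $ i\<bar>) \<le> (\<Sum>i\<in>(UNIV::'p set). lp_norm d x)"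
    by (intro sum_mono)
  then show ?thesis
    using norm_le_l1_cart[of x] by simp
qed

text \<open>\<open>row_onorm\<close> is a supremum of reals, so it bounds the quotients only once
  they are known to be bounded above; the sum of the row norms serves as that bound. At
  \<open>u = 0\<close> the quotient is 0 by convention and carries no information, hence the case
  split.\<close>

lemma L2_set_le_row_onorm:
  fixes A :: "nat \<Rightarrow> real ^ 'p"
  shows "L2_set (\<lambda>k. A k \<bullet> u) {..<r} \<le> row_onorm r A * norm u"
proof (cases "u = 0")
  case True
  then show ?thesis by (simp add: L2_set_def)
next
  case False
  have "bdd_above (range (\<lambda>u. L2_set (\<lambda>k. A k \<bullet> u) {..<r} / norm u))"
  proof (rule bdd_aboveI2)
    fix u :: "real ^ 'p"
    have "L2_set (\<lambda>k. A k \<bullet> u) {..<r} \<le> (\<Sum>k<r. \<bar>A k \<bullet> u\<bar>)"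
      by (rule L2_set_le_sum_abs)
    also have "\<dots> \<le> (\<Sum>k<r. norm (A k) * norm u)"
      by (intro sum_mono Cauchy_Schwarz_ineq2)
    finally show "L2_set (\<lambda>k. A k \<bullet> u) {..<r} / norm u \<le> (\<Sum>k<r. norm (A k))"
      by (cases "u = 0") (simp_all add: sum_nonneg divide_simps sum_distrib_right)
  qed
  then have "L2_set (\<lambda>k. A k \<bullet> u) {..<r} / norm u \<le> row_onorm r A"
    unfolding row_onorm_def by (rule cSUP_upper[rotated]) simp
  then show ?thesis
    using False by (simp add: divide_simps)
qed

lemma row_onorm_nonneg: "0 \<le> row_onorm r (A :: nat \<Rightarrow> real ^ 'p)"
proof -
  obtain b :: "real ^ 'p" where "norm b = 1"
    using vector_choose_size[of 1] by auto
  then show ?thesis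
    using order_trans[OF L2_set_nonneg L2_set_le_row_onorm[of A b r]] by simp
qed

text \<open>The transposed matrix has the same operator norm; this is the inequality by duality.\<close>

lemma norm_weighted_rows_le:
  fixes A :: "nat \<Rightarrow> real ^ 'p"
  shows "norm (\<Sum>k<r. c k *\<^sub>R A k) \<le> row_onorm r A * L2_set c {..<r}"
proof -
  define q where "q = (\<Sum>k<r. c k *\<^sub>R A k)"
  have "norm q * norm q = (\<Sum>k<r. c k * (A k \<bullet> q))"
    by (subst power2_eq_square[symmetric], subst power2_norm_eq_inner)
       (simp add: q_def inner_sum_left)
  also have "\<dots> \<le> (\<Sum>k<r. \<bar>c k\<bar> * \<bar>A k \<bullet> q\<bar>)"
    by (intro sum_mono) (metis abs_ge_self abs_mult)
  also have "\<dots> \<le> L2_set c {..<r} * L2_set (\<lambda>k. A k \<bullet> q) {..<r}"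
    by (rule L2_set_mult_ineq)
  also have "\<dots> \<le> L2_set c {..<r} * (row_onorm r A * norm q)"
    by (intro mult_left_mono L2_set_le_row_onorm) auto
  finally have "norm q * norm q \<le> (row_onorm r A * L2_set c {..<r}) * norm q"
    by (simp add: mult_ac)
  then have "norm q \<le> row_onorm r A * L2_set c {..<r}"
    by (cases "norm q = 0") (auto simp: row_onorm_nonneg mult_le_cancel_right)
  then show ?thesis by (simp add: q_def)
qed

text \<open>The norm of a stacked vector is the Euclidean norm of its block norms, which their sum
  dominates. This splits the stacked violation in \<open>net_ccv\<close> into the contributions of
  the agents.\<close>

lemma L2_set_Sigma_le:
  assumes "finite I" "\<And>i. i \<in> I \<Longrightarrow> finite (K i)"
  shows "L2_set (\<lambda>(i, k). f i k) (Sigma I K) \<le> (\<Sum>i\<in>I. L2_set (f i) (K i))"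
proof -
  have "L2_set (\<lambda>(i, k). f i k) (Sigma I K) = L2_set (\<lambda>i. L2_set (f i) (K i)) I"
    using assms unfolding L2_set_def
    by (simp add: sum_nonneg case_prod_unfold
          sum.Sigma[of I K "\<lambda>i k. (f i k)\<^sup>2", unfolded case_prod_unfold])
  also have "\<dots> \<le> (\<Sum>i\<in>I. L2_set (f i) (K i))"
    by (intro L2_set_le_sum) auto
  finally show ?thesis .
qed

text \<open>An integral comparison in discrete form: by the mean value theorem the increment of T^(1
  - a) from T to T + 1 is at least (1 - a) (T + 1)^(-a), because the derivative decreases.\<close>

lemma sum_powr_le:
  assumes "0 \<le> a" "a < 1"
  shows "(\<Sum>t=1..T. real t powr (- a)) \<le> real T powr (1 - a) / (1 - a)"
proof (induction T)
  case (Suc T)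
  have "real T powr (1 - a) + (1 - a) * real (Suc T) powr (- a) \<le> real (Suc T) powr (1 - a)"
  \<comment> \<open>The power need not be differentiable at 0, so the first increment is computed
    directly with \<open>0 powr (1 - a) = 0\<close>.\<close>
  proof (cases "T = 0")
    case False
    have "\<exists>z::real. real T < z \<and> z < real (Suc T) \<and>
        real (Suc T) powr (1 - a) - real T powr (1 - a)
          = (real (Suc T) - real T) * ((1 - a) * z powr (1 - a - 1))"
      using False by (intro MVT2 has_real_derivative_powr) auto
    then obtain z where z: "real T < z" "z < real (Suc T)"
      "real (Suc T) powr (1 - a) - real T powr (1 - a) = (1 - a) * z powr (- a)"
      by auto
    have "real (Suc T) powr (- a) \<le> z powr (- a)"
      using z assms by (intro powr_mono2') auto
    then have "(1 - a) * real (Suc T) powr (- a) \<le> (1 - a) * z powr (- a)"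
      using assms by (intro mult_left_mono) auto
    then show ?thesis using z by simp
  qed (use assms in auto)
  then show ?case
    using Suc assms by (simp add: field_simps)
qed (use assms in auto)

section \<open>Consensus\<close>

text \<open>The product of \<open>k\<close> matrices starting with \<open>A s\<close>, newest factor
  on the left, so that it carries a state at time \<open>s\<close> to time
  \<open>s + k\<close>.\<close>

fun transition :: "(nat \<Rightarrow> real ^ 'n ^ 'n) \<Rightarrow> nat \<Rightarrow> nat \<Rightarrow> real ^ 'n::finite ^ 'n" where
  "transition A s 0 = mat 1"
| "transition A s (Suc k) = A (s + k) ** transition A s k"

lemma transition_Suc_nth:
  "transition A s (Suc k) $ i $ j = (\<Sum>l\<in>UNIV. A (s + k) $ i $ l * transition A s k $ l $ j)"
  by (simp add: matrix_matrix_mult_def)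

lemma transition_stochastic:
  assumes "\<And>k. doubly_stochastic (A (s + k))"
  shows "0 \<le> transition A s k $ i $ j" "(\<Sum>j\<in>UNIV. transition A s k $ i $ j) = 1"
proof -
  have A: "0 \<le> A (s + k) $ i $ j" "(\<Sum>j\<in>UNIV. A (s + k) $ i $ j) = 1" for i j k
    using assms[of k] by (auto simp: doubly_stochastic_def)
  show "0 \<le> transition A s k $ i $ j"
  proof (induction k arbitrary: i)
    case 0
    then show ?case by (simp add: mat_def)
  next
    case (Suc k)
    then show ?case
      unfolding transition_Suc_nth using A by (intro sum_nonneg mult_nonneg_nonneg) auto
  qed
  show "(\<Sum>j\<in>UNIV. transition A s k $ i $ j) = 1"
  proof (induction k arbitrary: i)
    case 0
    then show ?case by (simp add: mat_def)
  next
    case (Suc k)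
    have "(\<Sum>j\<in>UNIV. transition A s (Suc k) $ i $ j)
        = (\<Sum>l\<in>UNIV. A (s + k) $ i $ l * (\<Sum>j\<in>UNIV. transition A s k $ l $ j))"
      unfolding transition_Suc_nth sum_distrib_left by (rule sum.swap)
    then show ?case using Suc A by simp
  qed
qed

text \<open>The entries of column \<open>j\<close> that are at least \<open>w ^ k\<close> are never lost, and over each window
  of \<open>B\<close> steps strong connectivity adds a new one.\<close>

lemma transition_ge_power:
  fixes A :: "nat \<Rightarrow> real ^ 'n::finite ^ 'n"
  assumes A: "\<And>k. doubly_stochastic (A (s + k))"
    and w: "0 < w"
    and edge: "\<And>k i j. (j, i) \<in> E (s + k) \<or> i = j \<Longrightarrow> A (s + k) $ i $ j \<ge> w"
    and B: "B > 0" "\<And>k. strongly_connected (\<Union>l\<in>{0..B - 1}. E (s + k + l))"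
  shows "transition A s (CARD('n) * B) $ i $ j \<ge> w ^ (CARD('n) * B)"
proof -
  define S where "S k = {i. transition A s k $ i $ j \<ge> w ^ k}" for k
  \<comment> \<open>One factor contributes at least \<open>w\<close> along an edge, and also on the
    diagonal. The diagonal case \<open>b = a\<close> is what keeps old members in the set.\<close>
  have step: "b \<in> S (Suc k)" if "a \<in> S k" "(a, b) \<in> E (s + k) \<or> b = a" for a b k
  proof -
    have "w ^ Suc k \<le> A (s + k) $ b $ a * transition A s k $ a $ j"
      using that edge[of a b k] w by (auto simp: S_def intro!: mult_mono)
    also have "\<dots> \<le> transition A s (Suc k) $ b $ j"
      unfolding transition_Suc_nth
      using A[of k] transition_stochastic(1)[of A s, OF A]
      by (intro member_le_sum) (auto simp: doubly_stochastic_def)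
    finally show ?thesis by (simp add: S_def)
  qed
  have mono: "S k \<subseteq> S (k + l)" for k l
    by (induction l) (use step in auto)
  have grow: "card (S (c * B)) \<ge> min (CARD('n)) (Suc c)" for c
  proof (induction c)
    case 0
    have "j \<in> S 0" by (simp add: S_def mat_def)
    then have "card (S 0) > 0" by (auto simp: card_gt_0_iff)
    then show ?case by simp
  next
    case (Suc c)
    let ?k = "c * B"
    have sub: "S ?k \<subseteq> S (Suc c * B)" using mono[of ?k B] by (simp add: add.commute)
    show ?case
    proof (cases "S ?k = UNIV")
      case True
      then have "S (Suc c * B) = UNIV" using sub by auto
      then show ?thesis by simp
    next
      case False
      have "j \<in> S 0" by (simp add: S_def mat_def)
      then have j: "j \<in> S ?k" using mono[of 0 ?k] by auto
      obtain b where b: "b \<notin> S ?k" using False by auto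
      \<comment> \<open>The edges of the window starting at offset \<open>c * B\<close>. A path in
        \<open>U\<close> from \<open>j\<close>, which is in the set, to \<open>b\<close>, which is
        not, must contain an edge leaving the set.\<close>
      define U where "U = (\<Union>l\<in>{0..B - 1}. E (s + ?k + l))"
      have "(j, b) \<in> U\<^sup>*"
        using B(2)[of ?k] by (auto simp: strongly_connected_def U_def)
      then have "\<exists>u v. u \<in> S ?k \<and> v \<notin> S ?k \<and> (u, v) \<in> U"
        using b
      proof (induction rule: rtrancl_induct)
        case base
        then show ?case using j by simp
      next
        case (step y z)
        then show ?case by (cases "y \<in> S ?k") blast+
      qed
      then obtain u v l where uv: "u \<in> S ?k" "v \<notin> S ?k" "l \<le> B - 1" "(u, v) \<in> E (s + ?k + l)"
        by (auto simp: U_def)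
      have "u \<in> S (?k + l)" using uv(1) mono by blast
      then have "v \<in> S (Suc (?k + l))"
        using uv(4) by (intro step[of u]) (auto simp: add.assoc)
      \<comment> \<open>The crossing edge acts somewhere inside the window, at offset
        \<open>l\<close>; persistence over the remaining \<open>B - 1 - l\<close> steps carries the
        new member to the end of the window.\<close>
      moreover have "Suc (?k + l) + (B - 1 - l) = Suc c * B"
        using uv(3) B(1) by simp
      then have "S (Suc (?k + l)) \<subseteq> S (Suc c * B)"
        using mono[of "Suc (?k + l)" "B - 1 - l"] by metis
      ultimately have "v \<in> S (Suc c * B)" by blast
      then have "card (S ?k) < card (S (Suc c * B))"
        using sub uv(2) by (intro psubset_card_mono) auto
      then show ?thesis using Suc by simp
    qed
  qed
  have "card (S (CARD('n) * B)) \<ge> CARD('n)" using grow[of "CARD('n)"] by simp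
  then have "S (CARD('n) * B) = UNIV"
    by (simp add: card_seteq)
  then show ?thesis by (auto simp: S_def)
qed

section \<open>Contraction of the disagreement\<close>

definition diam :: "('n::finite \<Rightarrow> 'a::real_normed_vector) \<Rightarrow> real" where
  "diam x = Max (range (\<lambda>(i, j). norm (x i - x j)))"

lemma norm_diff_le_diam: "norm (x i - x j) \<le> diam x"
  unfolding diam_def by (rule Max_ge) auto

lemma diam_leI: "(\<And>i j. norm (x i - x j) \<le> c) \<Longrightarrow> diam x \<le> c"
  unfolding diam_def by (subst Max_le_iff) auto

lemma diam_nonneg: "0 \<le> diam x"
  using norm_diff_le_diam[of x undefined undefined] by simp

text \<open>Dobrushin's argument: the mass \<open>\<eta>\<close> common to all weights cancels in
  the difference. What remains are two nonnegative weightings of equal total mass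
  \<open>\<rho>\<close>, and these are coupled by their product.\<close>

lemma norm_convex_combination_diff_le:
  fixes x :: "'n::finite \<Rightarrow> 'a::real_normed_vector"
  assumes p: "\<And>k. p k \<ge> \<eta>" "(\<Sum>k\<in>UNIV. p k) = 1"
    and q: "\<And>k. q k \<ge> \<eta>" "(\<Sum>k\<in>UNIV. q k) = 1"
  shows "norm ((\<Sum>k\<in>UNIV. p k *\<^sub>R x k) - (\<Sum>k\<in>UNIV. q k *\<^sub>R x k))
           \<le> (1 - real CARD('n) * \<eta>) * diam x"
proof -
  define \<rho> where "\<rho> = 1 - real CARD('n) * \<eta>"
  define p' q' where "p' k = p k - \<eta>" and "q' k = q k - \<eta>" for k
  have nonneg: "p' k \<ge> 0" "q' k \<ge> 0" for k using p q by (auto simp: p'_def q'_def)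
  have sums: "(\<Sum>k\<in>UNIV. p' k) = \<rho>" "(\<Sum>k\<in>UNIV. q' k) = \<rho>"
    using p(2) q(2) by (auto simp: p'_def q'_def sum_subtractf \<rho>_def)
  have "\<rho> \<ge> 0"
    unfolding sums(1)[symmetric] by (intro sum_nonneg nonneg)
  have diff: "(\<Sum>k\<in>UNIV. p k *\<^sub>R x k) - (\<Sum>k\<in>UNIV. q k *\<^sub>R x k)
      = (\<Sum>k\<in>UNIV. p' k *\<^sub>R x k) - (\<Sum>k\<in>UNIV. q' k *\<^sub>R x k)"
    by (simp add: p'_def q'_def algebra_simps sum_subtractf)
  \<comment> \<open>Multiplying by \<open>\<rho>\<close> plays the part of normalizing the residual
    weights, without dividing by a number that may be 0.\<close>
  have "\<rho> *\<^sub>R ((\<Sum>k\<in>UNIV. p' k *\<^sub>R x k) - (\<Sum>k\<in>UNIV. q' k *\<^sub>R x k))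
      = (\<Sum>k\<in>UNIV. \<Sum>l\<in>UNIV. (p' k * q' l) *\<^sub>R (x k - x l))"
  proof -
    have "(\<Sum>k\<in>UNIV. \<Sum>l\<in>UNIV. (p' k * q' l) *\<^sub>R x k)
        = (\<Sum>k\<in>UNIV. (p' k * (\<Sum>l\<in>UNIV. q' l)) *\<^sub>R x k)"
      by (simp only: sum_distrib_left scaleR_sum_left)
    also have "\<dots> = \<rho> *\<^sub>R (\<Sum>k\<in>UNIV. p' k *\<^sub>R x k)"
      by (simp add: sums scaleR_sum_right mult.commute)
    moreover have "(\<Sum>k\<in>UNIV. \<Sum>l\<in>UNIV. (p' k * q' l) *\<^sub>R x l)
        = (\<Sum>l\<in>UNIV. ((\<Sum>k\<in>UNIV. p' k) * q' l) *\<^sub>R x l)"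
      by (simp only: sum_distrib_right scaleR_sum_left) (rule sum.swap)
    then have "(\<Sum>k\<in>UNIV. \<Sum>l\<in>UNIV. (p' k * q' l) *\<^sub>R x l) = \<rho> *\<^sub>R (\<Sum>l\<in>UNIV. q' l *\<^sub>R x l)"
      by (simp add: sums scaleR_sum_right)
    ultimately show ?thesis by (simp add: scaleR_diff_right sum_subtractf)
  qed
  from arg_cong[OF this, of norm] \<open>\<rho> \<ge> 0\<close>
  have "\<rho> * norm ((\<Sum>k\<in>UNIV. p' k *\<^sub>R x k) - (\<Sum>k\<in>UNIV. q' k *\<^sub>R x k))
      = norm (\<Sum>k\<in>UNIV. \<Sum>l\<in>UNIV. (p' k * q' l) *\<^sub>R (x k - x l))"
    by (simp only: norm_scaleR abs_of_nonneg)
  also have "\<dots> \<le> (\<Sum>k\<in>UNIV. \<Sum>l\<in>UNIV. (p' k * q' l) * diam x)"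
  proof (intro sum_norm_le)
    fix k l
    show "norm ((p' k * q' l) *\<^sub>R (x k - x l)) \<le> p' k * q' l * diam x"
      using nonneg by (simp add: mult_left_mono norm_diff_le_diam)
  qed
  also have "\<dots> = (\<Sum>k\<in>UNIV. p' k) * (\<Sum>l\<in>UNIV. q' l) * diam x"
    unfolding sum_product by (simp only: sum_distrib_right)
  also have "\<dots> = \<rho> * (\<rho> * diam x)"
    by (simp add: sums)
  finally have *: "\<rho> * norm ((\<Sum>k\<in>UNIV. p' k *\<^sub>R x k) - (\<Sum>k\<in>UNIV. q' k *\<^sub>R x k))
      \<le> \<rho> * (\<rho> * diam x)" .
  \<comment> \<open>The factor \<open>\<rho>\<close> can be cancelled unless it is 0, and in that
    case all residual weights vanish, so both combinations coincide.\<close>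
  show ?thesis
  proof (cases "\<rho> = 0")
    case True
    have "p' k = 0" "q' k = 0" for k
      using sums nonneg True by (auto simp: sum_nonneg_eq_0_iff)
    then show ?thesis unfolding diff by (simp add: True flip: \<rho>_def)
  next
    case False
    then show ?thesis
      using * \<open>\<rho> \<ge> 0\<close> unfolding diff \<rho>_def[symmetric] by simp
  qed
qed

text \<open>Over \<open>N\<close> steps the diameter shrinks by the factor \<open>\<rho>\<close> up
  to accumulated perturbations. Summing this inequality over time, instead of unrolling a geometric
  series, puts the whole sum on both sides; subtracting leaves the gap \<open>1 - \<rho>\<close>,
  which is the constant on the left.\<close>

lemma sum_diam_le:
  fixes x \<eta> :: "nat \<Rightarrow> 'n::finite \<Rightarrow> 'a::real_normed_vector"
  assumes W: "\<And>t. t \<ge> 1 \<Longrightarrow> doubly_stochastic (W t)"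
    and w: "0 < w"
    and edge: "\<And>t i j. t \<ge> 1 \<Longrightarrow> (j, i) \<in> E t \<or> i = j \<Longrightarrow> W t $ i $ j \<ge> w"
    and B: "B > 0" "\<And>t. t \<ge> 1 \<Longrightarrow> strongly_connected (\<Union>l\<in>{0..B - 1}. E (t + l))"
    and x: "\<And>t i. t \<ge> 1 \<Longrightarrow> x (Suc t) i = (\<Sum>j\<in>UNIV. W (Suc t) $ i $ j *\<^sub>R (x t j + \<eta> t j))"
    and R: "\<And>t i. t \<ge> 1 \<Longrightarrow> norm (x t i) \<le> R"
  shows "real CARD('n) * w ^ (CARD('n) * B) * (\<Sum>t=1..T. diam (x t))
    \<le> 2 * real (CARD('n) * B) * (R + (\<Sum>t=1..<T. \<Sum>j\<in>UNIV. norm (\<eta> t j)))"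
proof -
  define N where "N = CARD('n) * B"
  define \<Delta> where "\<Delta> t = (\<Sum>j\<in>UNIV. norm (\<eta> t j))" for t
  \<comment> \<open>The state at \<open>Suc t\<close> is mixed by \<open>W (Suc t)\<close>; shifting
    the index by one lets \<open>transition A s k\<close> lead from time \<open>s\<close> to time
    \<open>s + k\<close>.\<close>
  define A where "A t = W (Suc t)" for t
  define E' where "E' t = E (Suc t)" for t
  define \<rho> where "\<rho> = 1 - real CARD('n) * w ^ N"
  have \<Delta>: "0 \<le> \<Delta> t" "norm (\<eta> t j) \<le> \<Delta> t" for t j
    by (auto simp: \<Delta>_def sum_nonneg intro: member_le_sum)
  have A: "doubly_stochastic (A (s + k))" if "s \<ge> 1" for s k
    using W[of "Suc (s + k)"] by (simp add: A_def)
  have pos: "w ^ N \<le> transition A s N $ i $ j" if s: "s \<ge> 1" for s i j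
    unfolding N_def
  proof (rule transition_ge_power[where E = E'])
    fix k show "strongly_connected (\<Union>l\<in>{0..B - 1}. E' (s + k + l))"
      using B(2)[of "Suc (s + k)"] by (simp add: E'_def)
  qed (use A s w B(1) edge in \<open>auto simp: A_def E'_def\<close>)
  \<comment> \<open>Comparison with unperturbed averaging started at time \<open>s\<close>: each
    further averaging does not enlarge a bound common to all agents, so the perturbations merely add
    up.\<close>
  have track: "norm (x (s + k) i - (\<Sum>j\<in>UNIV. transition A s k $ i $ j *\<^sub>R x s j))
      \<le> (\<Sum>l<k. \<Delta> (s + l))" if s: "s \<ge> 1" for s k i
  proof (induction k arbitrary: i)
    case 0
    have "(\<Sum>j\<in>UNIV. (mat 1 :: real^'n^'n) $ i $ j *\<^sub>R x s j) = (\<Sum>j\<in>UNIV. if j = i then x s j else 0)"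
      by (intro sum.cong) (auto simp: mat_def)
    then show ?case by simp
  next
    case (Suc k)
    let ?y = "\<lambda>l. \<Sum>j\<in>UNIV. transition A s k $ l $ j *\<^sub>R x s j"
    have a: "0 \<le> A (s + k) $ i $ l" "(\<Sum>l\<in>UNIV. A (s + k) $ i $ l) = 1" for l
      using A[OF s, of k] by (auto simp: doubly_stochastic_def)
    have "(\<Sum>j\<in>UNIV. transition A s (Suc k) $ i $ j *\<^sub>R x s j)
        = (\<Sum>l\<in>UNIV. A (s + k) $ i $ l *\<^sub>R ?y l)"
      unfolding transition_Suc_nth scaleR_sum_left scaleR_sum_right scaleR_scaleR by (rule sum.swap)
    moreover have "x (s + Suc k) i
        = (\<Sum>l\<in>UNIV. A (s + k) $ i $ l *\<^sub>R (x (s + k) l + \<eta> (s + k) l))"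
      using x[of "s + k" i] s by (simp add: A_def)
    ultimately have "x (s + Suc k) i - (\<Sum>j\<in>UNIV. transition A s (Suc k) $ i $ j *\<^sub>R x s j)
        = (\<Sum>l\<in>UNIV. A (s + k) $ i $ l *\<^sub>R ((x (s + k) l - ?y l) + \<eta> (s + k) l))"
      by (simp add: algebra_simps sum.distrib sum_subtractf)
    also have "norm \<dots> \<le> (\<Sum>l\<in>UNIV. A (s + k) $ i $ l * ((\<Sum>l<k. \<Delta> (s + l)) + \<Delta> (s + k)))"
      using Suc \<Delta>(2) a(1)
      by (intro sum_norm_le) (auto intro!: mult_left_mono order_trans[OF norm_triangle_ineq] add_mono)
    also have "\<dots> = (\<Sum>l<Suc k. \<Delta> (s + l))"
      using a(2) by (simp flip: sum_distrib_right)
    finally show ?case .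
  qed
  have contract: "diam (x (s + N)) \<le> \<rho> * diam (x s) + 2 * (\<Sum>l<N. \<Delta> (s + l))" if s: "s \<ge> 1" for s
  proof (rule diam_leI)
    fix i j
    let ?y = "\<lambda>i. \<Sum>j\<in>UNIV. transition A s N $ i $ j *\<^sub>R x s j"
    have "norm (?y i - ?y j) \<le> \<rho> * diam (x s)"
      unfolding \<rho>_def using pos[OF s] transition_stochastic(2)[of A s, OF A[OF s]]
      by (intro norm_convex_combination_diff_le) auto
    moreover have "norm (x (s + N) i - x (s + N) j)
        = norm ((x (s + N) i - ?y i) + (?y i - ?y j) - (x (s + N) j - ?y j))"
      by simp
    moreover have "\<dots> \<le> norm (x (s + N) i - ?y i) + norm (?y i - ?y j) + norm (x (s + N) j - ?y j)"
      by (rule order_trans[OF norm_triangle_ineq4 add_right_mono[OF norm_triangle_ineq]])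
    ultimately show "norm (x (s + N) i - x (s + N) j) \<le> \<rho> * diam (x s) + 2 * (\<Sum>l<N. \<Delta> (s + l))"
      using track[OF s, of N i] track[OF s, of N j] by linarith
  qed
  have \<rho>: "\<rho> \<ge> 0"
  proof -
    have "(\<Sum>j\<in>(UNIV::'n set). w ^ N) \<le> (\<Sum>j\<in>UNIV. transition A 1 N $ undefined $ j)"
      using pos by (intro sum_mono) auto
    then show ?thesis
      using transition_stochastic(2)[of A 1 N undefined, OF A] by (simp add: \<rho>_def)
  qed
  have diamR: "diam (x t) \<le> 2 * R" if "t \<ge> 1" for t
    using add_mono[OF R[OF that] R[OF that]]
    by (auto intro!: diam_leI order_trans[OF norm_triangle_ineq4])
  have "(\<Sum>t=1..T. diam (x t)) \<le> 2 * real N * R + \<rho> * (\<Sum>t=1..T. diam (x t))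
      + 2 * real N * (\<Sum>t=1..<T. \<Delta> t)"
  proof -
    \<comment> \<open>The first \<open>N\<close> terms have no predecessor \<open>N\<close> steps
      earlier and are bounded by \<open>2 * R\<close> each. Enlarging the index set covers the case
      \<open>T < N\<close>.\<close>
    have "(\<Sum>t=1..T. diam (x t)) \<le> (\<Sum>t\<in>{1..N} \<union> {N+1..T}. diam (x t))"
      by (intro sum_mono2) (auto simp: diam_nonneg)
    also have "\<dots> = (\<Sum>t=1..N. diam (x t)) + (\<Sum>t=N+1..T. diam (x t))"
      by (rule sum.union_disjoint) auto
    finally have split: "(\<Sum>t=1..T. diam (x t)) \<le> \<dots>" .
    have head: "(\<Sum>t=1..N. diam (x t)) \<le> real N * (2 * R)"
      using sum_mono[of "{1..N}" "\<lambda>t. diam (x t)" "\<lambda>t. 2 * R"] diamR by simp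
    \<comment> \<open>Since \<open>l < N\<close>, the shifted times stay below \<open>T\<close>.
      Hence each perturbation is counted at most \<open>N\<close> times overall, once for every
      \<open>l\<close>.\<close>
    have tail: "(\<Sum>t=1..T-N. \<Delta> (t + l)) \<le> (\<Sum>t=1..<T. \<Delta> t)" if "l < N" for l
    proof -
      have "(\<Sum>t=1..T-N. \<Delta> (t + l)) = (\<Sum>t\<in>(\<lambda>t. t + l) ` {1..T-N}. \<Delta> t)"
        by (subst sum.reindex) (auto simp: inj_on_def)
      also have "\<dots> \<le> (\<Sum>t=1..<T. \<Delta> t)"
        using that by (intro sum_mono2) (auto simp: \<Delta>)
      finally show ?thesis .
    qed
    have "(\<Sum>t=N+1..T. diam (x t)) = (\<Sum>t=1..T-N. diam (x (t + N)))"
      by (rule sum.reindex_bij_witness[where i = "\<lambda>t. t + N" and j = "\<lambda>t. t - N"]) auto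
    also have "\<dots> \<le> (\<Sum>t=1..T-N. \<rho> * diam (x t) + 2 * (\<Sum>l<N. \<Delta> (t + l)))"
      by (intro sum_mono contract) auto
    also have "\<dots> = \<rho> * (\<Sum>t=1..T-N. diam (x t)) + 2 * (\<Sum>t=1..T-N. \<Sum>l<N. \<Delta> (t + l))"
      by (simp add: sum.distrib sum_distrib_left)
    also have "\<dots> = \<rho> * (\<Sum>t=1..T-N. diam (x t)) + 2 * (\<Sum>l<N. \<Sum>t=1..T-N. \<Delta> (t + l))"
      by (subst sum.swap) (rule refl)
    also have "\<dots> \<le> \<rho> * (\<Sum>t=1..T. diam (x t)) + 2 * (\<Sum>l<N. \<Sum>t=1..<T. \<Delta> t)"
      using \<rho> by (intro add_mono mult_left_mono sum_mono2 sum_mono tail) (auto simp: diam_nonneg)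
    finally show ?thesis
      using split head by simp
  qed
  then have "(1 - \<rho>) * (\<Sum>t=1..T. diam (x t)) \<le> 2 * real N * (R + (\<Sum>t=1..<T. \<Delta> t))"
    by (simp add: algebra_simps)
  then show ?thesis by (simp add: \<rho>_def N_def \<Delta>_def)
qed

section \<open>One run of the algorithm\<close>

text \<open>Jensen's inequality for the squared norm, read off from the nonnegativity of the
  weighted variance about the mean \<open>c\<close>.\<close>

lemma norm_convex_combination_square_le:
  fixes a :: "'i \<Rightarrow> 'a::real_inner"
  assumes "\<And>j. j \<in> J \<Longrightarrow> p j \<ge> 0" "sum p J = 1"
  shows "(norm (\<Sum>j\<in>J. p j *\<^sub>R a j))\<^sup>2 \<le> (\<Sum>j\<in>J. p j * (norm (a j))\<^sup>2)"
proof -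
  define c where "c = (\<Sum>j\<in>J. p j *\<^sub>R a j)"
  have "0 \<le> (\<Sum>j\<in>J. p j * (norm (a j - c))\<^sup>2)"
    using assms by (intro sum_nonneg) auto
  also have "\<dots> = (\<Sum>j\<in>J. p j * (norm (a j))\<^sup>2 - 2 * (p j * (a j \<bullet> c)) + p j * (c \<bullet> c))"
    by (intro sum.cong refl) (simp add: power2_norm_eq_inner inner_diff inner_commute algebra_simps)
  also have "\<dots> = (\<Sum>j\<in>J. p j * (norm (a j))\<^sup>2) - 2 * (\<Sum>j\<in>J. p j * (a j \<bullet> c)) + sum p J * (c \<bullet> c)"
    by (simp add: sum.distrib sum_subtractf sum_distrib_left sum_distrib_right)
  also have "(\<Sum>j\<in>J. p j * (a j \<bullet> c)) = c \<bullet> c"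
    by (simp add: c_def inner_sum_left)
  finally show ?thesis
    using assms by (simp add: c_def power2_norm_eq_inner)
qed

text \<open>Abel summation for growing weights. The induction keeps the slack
  \<open>K - V (Suc T)\<close>, which pays for the increase of the weight at the next step. It
  serves with weights proportional to \<open>1 / \<alpha> t\<close> for the regret and with weight 1
  as a plain telescoping sum.\<close>

lemma sum_weighted_differences_le:
  fixes V c :: "nat \<Rightarrow> real"
  assumes V: "\<And>t. t \<ge> 1 \<Longrightarrow> 0 \<le> V t" "\<And>t. t \<ge> 1 \<Longrightarrow> V t \<le> K"
    and c: "\<And>t. t \<ge> 1 \<Longrightarrow> 0 \<le> c t" "\<And>t. t \<ge> 1 \<Longrightarrow> c t \<le> c (Suc t)"
    and T: "T \<ge> 1"
  shows "(\<Sum>t=1..T. c t * (V t - V (Suc t))) \<le> K * c T"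
proof -
  have "(\<Sum>t=1..T. c t * (V t - V (Suc t))) \<le> (K - V (Suc T)) * c T"
    using T
  proof (induction T rule: dec_induct)
    case base
    show ?case using mult_right_mono[OF V(2)[of 1] c(1)[of 1]] by (simp add: algebra_simps)
  next
    case (step T)
    have "0 \<le> (K - V (Suc T)) * (c (Suc T) - c T)"
      using V(2)[of "Suc T"] c(2)[of T] step(1) by (intro mult_nonneg_nonneg) auto
    then show ?case using step by (simp add: algebra_simps)
  qed
  also have "\<dots> \<le> K * c T"
    using V(1)[of "Suc T"] c(1)[OF T] by (intro mult_right_mono) auto
  finally show ?thesis .
qed

text \<open>The factor obtained from \<open>sum_diam_le\<close> by dividing by the contraction gap
  \<open>n * w ^ (n * B)\<close>.\<close>

definition mixing_const :: "nat \<Rightarrow> nat \<Rightarrow> real \<Rightarrow> real" where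
  "mixing_const n B w = 2 * real (n * B) / (real n * w ^ (n * B))"

text \<open>Here \<open>Comp\<close> is a fixed family of maps, so every bound is pathwise. The step
  sizes are general; their powers enter only with the rates. The bound on \<open>\<gamma>0\<close>
  is written as a product so that it makes sense for \<open>G2 = 0\<close>.\<close>

locale compressed_run =
  fixes X :: "(real ^ 'p) set"
    and m :: "'n::finite \<Rightarrow> nat"
    and df :: "'n \<Rightarrow> nat \<Rightarrow> real ^ 'p \<Rightarrow> real ^ 'p"
    and g :: "'n \<Rightarrow> nat \<Rightarrow> real ^ 'p \<Rightarrow> nat \<Rightarrow> real"
    and dg :: "'n \<Rightarrow> nat \<Rightarrow> real ^ 'p \<Rightarrow> nat \<Rightarrow> real ^ 'p"
    and E :: "nat \<Rightarrow> ('n \<times> 'n) set"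
    and W :: "nat \<Rightarrow> real ^ 'n ^ 'n"
    and B :: nat
    and \<alpha> \<gamma> s :: "nat \<Rightarrow> real"
    and z1 :: "'n \<Rightarrow> real ^ 'p"
    and Comp :: "'n \<Rightarrow> nat \<Rightarrow> real ^ 'p \<Rightarrow> real ^ 'p"
    and zh z x om :: "'n \<Rightarrow> nat \<Rightarrow> real ^ 'p"
    and v :: "'n \<Rightarrow> nat \<Rightarrow> nat \<Rightarrow> real"
    and R G1 G2 L w \<gamma>0 :: real
  assumes X: "convex X" "closed X" "\<And>y. y \<in> X \<Longrightarrow> norm y \<le> R"
    and g_subgradient: "\<And>i t k y. t \<ge> 1 \<Longrightarrow> k < m i \<Longrightarrow> y \<in> X \<Longrightarrow>
          subgradient_on X (\<lambda>u. g i t u k) y (dg i t y k)"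
    and f_bound: "\<And>i t y. t \<ge> 1 \<Longrightarrow> y \<in> X \<Longrightarrow> norm (df i t y) \<le> G1"
    and g_bound: "\<And>i t y. t \<ge> 1 \<Longrightarrow> y \<in> X \<Longrightarrow> row_onorm (m i) (dg i t y) \<le> G2"
    and f_Lipschitz: "\<And>i t y y'. t \<ge> 1 \<Longrightarrow> y \<in> X \<Longrightarrow> y' \<in> X \<Longrightarrow>
          norm (df i t y - df i t y') \<le> L * norm (y - y')"
    and w: "0 < w"
    and W_edge: "\<And>t i j. t \<ge> 1 \<Longrightarrow> (j, i) \<in> E t \<or> i = j \<Longrightarrow> W t $ i $ j \<ge> w"
    and W_stochastic: "\<And>t. t \<ge> 1 \<Longrightarrow> doubly_stochastic (W t)"
    and B: "B > 0" "\<And>t. t \<ge> 1 \<Longrightarrow> strongly_connected (\<Union>l\<in>{0..B - 1}. E (t + l))"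
    and \<gamma>0: "0 < \<gamma>0" "4 * G2\<^sup>2 * \<gamma>0 \<le> 1"
    and \<alpha>: "\<And>t. t \<ge> 1 \<Longrightarrow> 0 < \<alpha> t" "\<And>t. t \<ge> 1 \<Longrightarrow> \<alpha> (Suc t) \<le> \<alpha> t"
    and \<gamma>: "\<And>t. t \<ge> 1 \<Longrightarrow> \<gamma> t = \<gamma>0 / \<alpha> t"
    and s: "\<And>t. t \<ge> 1 \<Longrightarrow> 0 < s t"
    and z1: "\<And>i. z1 i \<in> X"
    and run: "algorithm_run X m df g dg W \<alpha> \<gamma> s z1 Comp zh z x v om"
begin

section \<open>Feasibility of the iterates and size of the perturbations\<close>

definition input :: "'n \<Rightarrow> nat \<Rightarrow> real ^ 'p" where
  "input j t = (z j t - zh j (t - 1)) /\<^sub>R s t"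

definition err :: "'n \<Rightarrow> nat \<Rightarrow> real" where
  "err j t = norm (Comp j t (input j t) - input j t)"

definition viol :: "'n \<Rightarrow> nat \<Rightarrow> real" where
  "viol i t = L2_set (\<lambda>k. max 0 (g i t (x i t) k)) {..<m i}"

definition lyap :: "real ^ 'p \<Rightarrow> nat \<Rightarrow> real" where
  "lyap y t = (\<Sum>i\<in>UNIV. (norm (z i t - y))\<^sup>2)"

lemma z_1: "z i 1 = z1 i"
  using run by (simp add: algorithm_run_def)

lemma run_step:
  assumes "t \<ge> 1"
  shows zh_step: "zh i t = closest_point X (zh i (t - 1) + s t *\<^sub>R Comp i t (input i t))"
    and x_step: "x i t = (\<Sum>j\<in>UNIV. W t $ i $ j *\<^sub>R zh j t)"
    and om_step: "om i (Suc t)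
      = df i t (x i t) + (\<Sum>k<m i. (\<gamma> t * max 0 (g i t (x i t) k)) *\<^sub>R dg i t (x i t) k)"
    and z_step: "z i (Suc t) = closest_point X (x i t - \<alpha> t *\<^sub>R om i (Suc t))"
  using run assms by (auto simp: algorithm_run_def input_def)

lemma X_nonempty: "X \<noteq> {}"
  using z1 by auto

lemma R_nonneg: "0 \<le> R"
  using X(3)[OF z1] norm_ge_zero order_trans by blast

lemma G_nonneg: "0 \<le> G1" "0 \<le> G2"
  using f_bound[OF order_refl z1] g_bound[OF order_refl z1] norm_ge_zero row_onorm_nonneg order_trans
  by blast+

lemma closest_point_in: "closest_point X a \<in> X"
  using X(2) X_nonempty by (rule closest_point_in_set)

lemma norm_closest_point_diff_le: "y \<in> X \<Longrightarrow> norm (closest_point X a - y) \<le> norm (a - y)"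
  using closest_point_lipschitz[OF X(1,2) X_nonempty, of a y] by (simp add: dist_norm closest_point_self)

lemma W_row: "t \<ge> 1 \<Longrightarrow> 0 \<le> W t $ i $ j" "t \<ge> 1 \<Longrightarrow> (\<Sum>j\<in>UNIV. W t $ i $ j) = 1"
    "t \<ge> 1 \<Longrightarrow> (\<Sum>i\<in>UNIV. W t $ i $ j) = 1"
  using W_stochastic by (auto simp: doubly_stochastic_def)

lemma zh_in: "t \<ge> 1 \<Longrightarrow> zh i t \<in> X"
  by (simp add: zh_step closest_point_in)

lemma z_in: "t \<ge> 1 \<Longrightarrow> z i t \<in> X"
  by (cases "t = 1") (use z1 z_1 z_step[of "t - 1" i] in \<open>auto simp: closest_point_in\<close>)

lemma x_in: "t \<ge> 1 \<Longrightarrow> x i t \<in> X"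
  using W_row zh_in X(1) by (auto simp: x_step intro!: convex_sum)

lemma norm_diff_le: "y \<in> X \<Longrightarrow> y' \<in> X \<Longrightarrow> norm (y - y') \<le> 2 * R"
  using norm_triangle_ineq4[of y y'] X(3)[of y] X(3)[of y'] by simp

text \<open>With an exact compressor the update would return \<open>z i t\<close>: adding
  \<open>s t\<close> times the input to the previous compressed variable cancels it. Since
  \<open>z i t\<close> lies in X, the projection does not increase the error that is left.\<close>

lemma norm_zh_z_le:
  assumes "t \<ge> 1"
  shows "norm (zh i t - z i t) \<le> s t * err i t"
proof -
  have "norm (zh i t - z i t) \<le> norm (zh i (t - 1) + s t *\<^sub>R Comp i t (input i t) - z i t)"
    using assms by (simp only: zh_step norm_closest_point_diff_le z_in)
  also have "zh i (t - 1) + s t *\<^sub>R Comp i t (input i t) - z i t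
      = s t *\<^sub>R (Comp i t (input i t) - input i t)"
    using s[OF assms] by (simp add: input_def algebra_simps)
  finally show ?thesis
    using s[OF assms] by (simp add: err_def)
qed

lemma viol_nonneg: "0 \<le> viol i t" and err_nonneg: "0 \<le> err i t"
  by (auto simp: viol_def err_def)

text \<open>The product \<open>\<alpha> t * \<gamma> t\<close> is constant, so the step size damps
  only the loss part; the constraint part stays comparable with the violation.\<close>

lemma norm_om_le:
  assumes t: "t \<ge> 1"
  shows "\<alpha> t * norm (om i (Suc t)) \<le> G1 * \<alpha> t + G2 * \<gamma>0 * viol i t"
proof -
  have \<gamma>t: "0 \<le> \<gamma> t" using \<gamma>[OF t] \<alpha>(1)[OF t] \<gamma>0(1) by simp
  have "norm (\<Sum>k<m i. (\<gamma> t * max 0 (g i t (x i t) k)) *\<^sub>R dg i t (x i t) k)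
      \<le> row_onorm (m i) (dg i t (x i t)) * L2_set (\<lambda>k. \<gamma> t * max 0 (g i t (x i t) k)) {..<m i}"
    by (rule norm_weighted_rows_le)
  also have "\<dots> \<le> G2 * L2_set (\<lambda>k. \<gamma> t * max 0 (g i t (x i t) k)) {..<m i}"
    by (intro mult_right_mono g_bound t x_in) auto
  also have "\<dots> = G2 * (\<gamma> t * viol i t)"
    using \<gamma>t by (simp add: viol_def L2_set_right_distrib)
  finally have "norm (om i (Suc t)) \<le> G1 + G2 * (\<gamma> t * viol i t)"
    unfolding om_step[OF t]
    using f_bound[OF t x_in[OF t], of i i] by (intro order_trans[OF norm_triangle_ineq] add_mono) auto
  then have "\<alpha> t * norm (om i (Suc t)) \<le> \<alpha> t * (G1 + G2 * (\<gamma> t * viol i t))"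
    using \<alpha>(1)[OF t] by (intro mult_left_mono) auto
  also have "\<dots> = G1 * \<alpha> t + G2 * \<gamma>0 * viol i t"
    using \<alpha>(1)[OF t] by (simp add: \<gamma>[OF t] field_simps)
  finally show ?thesis .
qed

lemma norm_z_x_le:
  assumes t: "t \<ge> 1"
  shows "norm (z i (Suc t) - x i t) \<le> G1 * \<alpha> t + G2 * \<gamma>0 * viol i t"
proof -
  have "norm (z i (Suc t) - x i t) \<le> norm (x i t - \<alpha> t *\<^sub>R om i (Suc t) - x i t)"
    unfolding z_step[OF t] by (intro norm_closest_point_diff_le x_in t)
  then show ?thesis
    using norm_om_le[OF t, of i] \<alpha>(1)[OF t] by simp
qed

text \<open>Convexity turns the constraint part into positive parts times
  \<open>g (x) - g (y)\<close>, and the first product is the squared violation. The sum with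
  \<open>g (y)\<close> is kept: a feasible comparator makes it nonpositive, a Slater point makes it
  negative in proportion to the violation.\<close>

lemma inner_om_ge:
  assumes t: "t \<ge> 1" and y: "y \<in> X"
  shows "\<alpha> t * (om i (Suc t) \<bullet> (x i t - y)) \<ge> \<alpha> t * (df i t (x i t) \<bullet> (x i t - y))
    + \<gamma>0 * (viol i t)\<^sup>2 - \<gamma>0 * (\<Sum>k<m i. max 0 (g i t (x i t) k) * g i t y k)"
proof -
  let ?p = "\<lambda>k. max 0 (g i t (x i t) k)"
  have "(viol i t)\<^sup>2 - (\<Sum>k<m i. ?p k * g i t y k) = (\<Sum>k<m i. ?p k * (g i t (x i t) k - g i t y k))"
    unfolding viol_def L2_set_def
    by (subst real_sqrt_pow2) (auto simp: sum_nonneg algebra_simps sum_subtractf power2_eq_square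
        max_def intro!: sum.cong)
  also have "\<dots> \<le> (\<Sum>k<m i. ?p k * (dg i t (x i t) k \<bullet> (x i t - y)))"
    using g_subgradient[OF t _ x_in[OF t], of _ i] y
    by (intro sum_mono mult_left_mono) (auto simp: subgradient_on_def inner_diff_right algebra_simps)
  finally have "\<gamma>0 * ((viol i t)\<^sup>2 - (\<Sum>k<m i. ?p k * g i t y k))
      \<le> \<gamma>0 * (\<Sum>k<m i. ?p k * (dg i t (x i t) k \<bullet> (x i t - y)))"
    using \<gamma>0 by (intro mult_left_mono) auto
  moreover have "\<alpha> t * (om i (Suc t) \<bullet> (x i t - y)) = \<alpha> t * (df i t (x i t) \<bullet> (x i t - y))
      + \<gamma>0 * (\<Sum>k<m i. ?p k * (dg i t (x i t) k \<bullet> (x i t - y)))"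
    using \<alpha>(1)[OF t]
    by (simp add: om_step[OF t] \<gamma>[OF t] inner_add_left inner_sum_left sum_distrib_left field_simps)
  ultimately show ?thesis by (simp add: algebra_simps)
qed

lemma descent:
  assumes t: "t \<ge> 1" and y: "y \<in> X"
  shows "2 * \<alpha> t * (df i t (x i t) \<bullet> (x i t - y)) + 3 / 2 * \<gamma>0 * (viol i t)\<^sup>2
    \<le> (norm (x i t - y))\<^sup>2 - (norm (z i (Suc t) - y))\<^sup>2 + 2 * G1\<^sup>2 * (\<alpha> t)\<^sup>2
      + 2 * \<gamma>0 * (\<Sum>k<m i. max 0 (g i t (x i t) k) * g i t y k)"
proof -
  let ?o = "\<alpha> t *\<^sub>R om i (Suc t)" and ?d = "x i t - y"
  have "norm (z i (Suc t) - y) \<le> norm (?d - ?o)"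
    using norm_closest_point_diff_le[OF y, of "x i t - ?o"]
    by (simp add: z_step[OF t] algebra_simps)
  then have "(norm (z i (Suc t) - y))\<^sup>2 \<le> (norm (?d - ?o))\<^sup>2"
    by (intro power_mono) auto
  also have "\<dots> = (norm ?d)\<^sup>2 - 2 * (\<alpha> t * (om i (Suc t) \<bullet> ?d)) + (norm ?o)\<^sup>2"
    unfolding power2_norm_eq_inner by (simp add: inner_diff inner_commute algebra_simps)
  finally have 1: "(norm (z i (Suc t) - y))\<^sup>2 \<le> \<dots>" .
  have "(norm ?o)\<^sup>2 \<le> (G1 * \<alpha> t + G2 * \<gamma>0 * viol i t)\<^sup>2"
    using norm_om_le[OF t, of i] \<alpha>(1)[OF t] by (intro power_mono) auto
  also have "\<dots> \<le> 2 * (G1 * \<alpha> t)\<^sup>2 + 2 * (G2 * \<gamma>0 * viol i t)\<^sup>2"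
    using sum_squares_bound[of "G1 * \<alpha> t" "G2 * \<gamma>0 * viol i t"] by (simp add: power2_sum)
  \<comment> \<open>Here the upper bound on \<open>\<gamma>0\<close> is spent: the factor in
    parentheses is at most 1, so the squared step takes half of \<open>\<gamma>0\<close> times the
    squared violation from the available two, which leaves 3 / 2.\<close>
  also have "2 * (G2 * \<gamma>0 * viol i t)\<^sup>2 = (4 * G2\<^sup>2 * \<gamma>0) * (\<gamma>0 * (viol i t)\<^sup>2 / 2)"
    by (simp add: power_mult_distrib power2_eq_square)
  also have "2 * (G1 * \<alpha> t)\<^sup>2 + \<dots> \<le> 2 * G1\<^sup>2 * (\<alpha> t)\<^sup>2 + 1 * (\<gamma>0 * (viol i t)\<^sup>2 / 2)"
    using \<gamma>0 by (intro add_mono mult_right_mono) (auto simp: power_mult_distrib)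
  finally show ?thesis
    using 1 inner_om_ge[OF t y, of i] by (simp add: algebra_simps)
qed

text \<open>Row sums equal to 1 allow Jensen's inequality for each agent; column sums equal to 1
  make the mixing weights disappear after summation over the agents.\<close>

lemma sum_x_square_le:
  assumes t: "t \<ge> 1" and y: "y \<in> X"
  shows "(\<Sum>i\<in>UNIV. (norm (x i t - y))\<^sup>2) \<le> lyap y t + 4 * R * (s t * (\<Sum>j\<in>UNIV. err j t))"
proof -
  have "(\<Sum>i\<in>UNIV. (norm (x i t - y))\<^sup>2)
      \<le> (\<Sum>i\<in>UNIV. \<Sum>j\<in>UNIV. W t $ i $ j * (norm (zh j t - y))\<^sup>2)"
  proof (intro sum_mono)
    fix i
    have "x i t - y = (\<Sum>j\<in>UNIV. W t $ i $ j *\<^sub>R (zh j t - y))"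
      using W_row(2)[OF t, of i]
      by (simp add: x_step[OF t] scaleR_diff_right sum_subtractf flip: scaleR_sum_left)
    then show "(norm (x i t - y))\<^sup>2 \<le> (\<Sum>j\<in>UNIV. W t $ i $ j * (norm (zh j t - y))\<^sup>2)"
      using W_row[OF t] by (auto intro!: norm_convex_combination_square_le)
  qed
  also have "\<dots> = (\<Sum>j\<in>UNIV. (\<Sum>i\<in>UNIV. W t $ i $ j) * (norm (zh j t - y))\<^sup>2)"
    unfolding sum_distrib_right by (rule sum.swap)
  also have "\<dots> = (\<Sum>j\<in>UNIV. (norm (zh j t - y))\<^sup>2)"
    using W_row[OF t] by simp
  also have "\<dots> \<le> (\<Sum>j\<in>UNIV. (norm (z j t - y))\<^sup>2 + 4 * R * (s t * err j t))"
  proof (intro sum_mono)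
    fix j
    let ?a = "norm (zh j t - y)" and ?b = "norm (z j t - y)"
    \<comment> \<open>Factoring the difference of squares leaves the compression error to the first
      power; the sum of the two distances is at most \<open>4 * R\<close>.\<close>
    have "?a\<^sup>2 - ?b\<^sup>2 = (?a - ?b) * (?a + ?b)"
      by (simp add: power2_eq_square algebra_simps)
    also have "\<dots> \<le> (s t * err j t) * (?a + ?b)"
      using norm_triangle_sub[of "zh j t - y" "z j t - y"] norm_zh_z_le[OF t, of j]
      by (intro mult_right_mono) auto
    also have "\<dots> \<le> (s t * err j t) * (4 * R)"
      using norm_diff_le[OF zh_in[OF t] y, of j] norm_diff_le[OF z_in[OF t] y, of j] s[OF t]
      by (intro mult_left_mono) (auto simp: err_nonneg)
    finally show "?a\<^sup>2 \<le> ?b\<^sup>2 + 4 * R * (s t * err j t)" by (simp add: mult_ac)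
  qed
  also have "\<dots> = lyap y t + 4 * R * (s t * (\<Sum>j\<in>UNIV. err j t))"
    by (simp add: lyap_def sum.distrib sum_distrib_left)
  finally show ?thesis .
qed

lemma sum_descent:
  assumes t: "t \<ge> 1" and y: "y \<in> X"
  shows "2 * \<alpha> t * (\<Sum>i\<in>UNIV. df i t (x i t) \<bullet> (x i t - y)) + 3 / 2 * \<gamma>0 * (\<Sum>i\<in>UNIV. (viol i t)\<^sup>2)
    \<le> lyap y t - lyap y (Suc t) + 4 * R * (s t * (\<Sum>j\<in>UNIV. err j t))
      + 2 * real CARD('n) * G1\<^sup>2 * (\<alpha> t)\<^sup>2
      + 2 * \<gamma>0 * (\<Sum>i\<in>UNIV. \<Sum>k<m i. max 0 (g i t (x i t) k) * g i t y k)"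
proof -
  have "(\<Sum>i\<in>(UNIV :: 'n set). 2 * \<alpha> t * (df i t (x i t) \<bullet> (x i t - y)) + 3 / 2 * \<gamma>0 * (viol i t)\<^sup>2)
    \<le> (\<Sum>i\<in>UNIV. (norm (x i t - y))\<^sup>2 - (norm (z i (Suc t) - y))\<^sup>2 + 2 * G1\<^sup>2 * (\<alpha> t)\<^sup>2
      + 2 * \<gamma>0 * (\<Sum>k<m i. max 0 (g i t (x i t) k) * g i t y k))"
    by (intro sum_mono descent t y)
  then show ?thesis
    using sum_x_square_le[OF t y]
    by (simp add: sum.distrib sum_subtractf sum_distrib_left lyap_def mult_ac)
qed

lemma lyap_bounds: "y \<in> X \<Longrightarrow> t \<ge> 1 \<Longrightarrow> lyap y t \<le> 4 * real CARD('n) * R\<^sup>2" "0 \<le> lyap y t"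
proof -
  assume *: "y \<in> X" "t \<ge> 1"
  have "lyap y t \<le> (\<Sum>i\<in>(UNIV :: 'n set). (2 * R)\<^sup>2)"
    unfolding lyap_def using * by (intro sum_mono power_mono norm_diff_le z_in) auto
  then show "lyap y t \<le> 4 * real CARD('n) * R\<^sup>2" by (simp add: power_mult_distrib)
qed (simp add: lyap_def sum_nonneg)

section \<open>Accumulated disagreement along a run\<close>

lemma mixing_const_nonneg: "0 \<le> mixing_const CARD('n) B w"
  using w by (simp add: mixing_const_def)

lemma sum_diam_x_le:
  "(\<Sum>t=1..T. diam (\<lambda>i. x i t)) \<le> mixing_const CARD('n) B w * (R + (\<Sum>t=1..T. s t * (\<Sum>j\<in>UNIV. err j t))
    + real CARD('n) * G1 * (\<Sum>t=1..T. \<alpha> t) + G2 * \<gamma>0 * (\<Sum>t=1..T. \<Sum>i\<in>UNIV. viol i t))"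
proof -
  \<comment> \<open>The perturbation between two mixings has two parts of different index: the
    projected step made at time \<open>t\<close> and the compression error made at time
    \<open>Suc t\<close>. The second is reindexed below and still ends by time
    \<open>T\<close>.\<close>
  define \<eta> where "\<eta> t j = (z j (Suc t) - x j t) + (zh j (Suc t) - z j (Suc t))" for t j
  let ?\<kappa> = "real CARD('n) * w ^ (CARD('n) * B)"
  have "?\<kappa> * (\<Sum>t=1..T. diam (\<lambda>i. x i t))
      \<le> 2 * real (CARD('n) * B) * (R + (\<Sum>t=1..<T. \<Sum>j\<in>UNIV. norm (\<eta> t j)))"
  proof (rule sum_diam_le[where E = E and W = W])
    fix t i assume t: "(1::nat) \<le> t"
    show "x i (Suc t) = (\<Sum>j\<in>UNIV. W (Suc t) $ i $ j *\<^sub>R (x j t + \<eta> t j))"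
      using x_step[of "Suc t" i] by (simp add: \<eta>_def)
    show "norm (x i t) \<le> R" using t by (intro X x_in)
  qed (use W_stochastic w W_edge B in auto)
  also have "\<dots> \<le> 2 * real (CARD('n) * B) * (R + (\<Sum>t=1..T. s t * (\<Sum>j\<in>UNIV. err j t))
    + real CARD('n) * G1 * (\<Sum>t=1..T. \<alpha> t) + G2 * \<gamma>0 * (\<Sum>t=1..T. \<Sum>i\<in>UNIV. viol i t))"
  proof -
    define a where "a t = real CARD('n) * G1 * \<alpha> t + G2 * \<gamma>0 * (\<Sum>i\<in>UNIV. viol i t)" for t
    define c where "c t = s t * (\<Sum>j\<in>UNIV. err j t)" for t
    have a: "0 \<le> a t" "0 \<le> c t" if "t \<ge> 1" for t
      using \<alpha>(1)[OF that] s[OF that] G_nonneg \<gamma>0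
      by (auto simp: a_def c_def viol_nonneg err_nonneg intro!: add_nonneg_nonneg mult_nonneg_nonneg sum_nonneg)
    have "(\<Sum>j\<in>UNIV. norm (\<eta> t j)) \<le> a t + c (Suc t)" if t: "t \<ge> 1" for t
    proof -
      have "(\<Sum>j\<in>UNIV. norm (\<eta> t j))
          \<le> (\<Sum>j\<in>UNIV. (G1 * \<alpha> t + G2 * \<gamma>0 * viol j t) + s (Suc t) * err j (Suc t))"
        unfolding \<eta>_def using norm_z_x_le[OF t] norm_zh_z_le[of "Suc t"]
        by (intro sum_mono order_trans[OF norm_triangle_ineq] add_mono) auto
      then show ?thesis by (simp add: sum.distrib a_def c_def sum_distrib_left mult_ac)
    qed
    then have "(\<Sum>t=1..<T. \<Sum>j\<in>UNIV. norm (\<eta> t j)) \<le> (\<Sum>t=1..<T. a t) + (\<Sum>t=1..<T. c (Suc t))"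
      by (subst sum.distrib[symmetric]) (intro sum_mono, auto)
    also have "(\<Sum>t=1..<T. c (Suc t)) = (\<Sum>t\<in>Suc ` {1..<T}. c t)"
      by (subst sum.reindex) auto
    also have "(\<Sum>t=1..<T. a t) + \<dots> \<le> (\<Sum>t=1..T. a t) + (\<Sum>t=1..T. c t)"
      by (intro add_mono sum_mono2) (auto simp: a)
    finally show ?thesis
      by (intro mult_left_mono) (auto simp: a_def c_def sum.distrib sum_distrib_left)
  qed
  finally have "(\<Sum>t=1..T. diam (\<lambda>i. x i t)) * ?\<kappa> \<le> \<dots>"
    by (simp only: mult.commute)
  then show ?thesis
    using w unfolding mixing_const_def times_divide_eq_left by (subst pos_le_divide_eq) auto
qed

text \<open>The descent inequality is summed without dividing by \<open>\<alpha> t\<close>. The loss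
  term is only bounded by Cauchy-Schwarz, which costs a multiple of \<open>\<alpha> t\<close>, and
  the squared step size is at most \<open>\<alpha> 1 * \<alpha> t\<close>; so the total is of the
  order of the sum of the step sizes.\<close>

lemma sum_viol_energy_le:
  assumes y: "y \<in> X"
  shows "3 / 2 * \<gamma>0 * (\<Sum>t=1..T. \<Sum>i\<in>UNIV. (viol i t)\<^sup>2)
      - 2 * \<gamma>0 * (\<Sum>t=1..T. \<Sum>i\<in>UNIV. \<Sum>k<m i. max 0 (g i t (x i t) k) * g i t y k)
    \<le> 4 * real CARD('n) * R\<^sup>2 + 4 * R * (\<Sum>t=1..T. s t * (\<Sum>j\<in>UNIV. err j t))
      + (2 * real CARD('n) * G1\<^sup>2 * \<alpha> 1 + 4 * real CARD('n) * R * G1) * (\<Sum>t=1..T. \<alpha> t)"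
proof -
  have \<alpha>1: "\<alpha> t \<le> \<alpha> 1" if "t \<ge> 1" for t
    using that by (induction t rule: dec_induct) (use \<alpha>(2) order_trans in auto)
  have step: "3 / 2 * \<gamma>0 * (\<Sum>i\<in>UNIV. (viol i t)\<^sup>2)
      - 2 * \<gamma>0 * (\<Sum>i\<in>UNIV. \<Sum>k<m i. max 0 (g i t (x i t) k) * g i t y k)
    \<le> (lyap y t - lyap y (Suc t)) + 4 * R * (s t * (\<Sum>j\<in>UNIV. err j t))
      + (2 * real CARD('n) * G1\<^sup>2 * \<alpha> 1 + 4 * real CARD('n) * R * G1) * \<alpha> t" if t: "t \<ge> 1" for t
  proof -
    have "- (G1 * (2 * R)) \<le> df i t (x i t) \<bullet> (x i t - y)" for i
    proof -
      have "\<bar>df i t (x i t) \<bullet> (x i t - y)\<bar> \<le> norm (df i t (x i t)) * norm (x i t - y)"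
        by (rule Cauchy_Schwarz_ineq2)
      also have "\<dots> \<le> G1 * (2 * R)"
        using G_nonneg by (intro mult_mono f_bound norm_diff_le x_in t y) auto
      finally show ?thesis by linarith
    qed
    then have "(\<Sum>i\<in>(UNIV::'n set). - (G1 * (2 * R))) \<le> (\<Sum>i\<in>UNIV. df i t (x i t) \<bullet> (x i t - y))"
      by (intro sum_mono)
    then have "2 * \<alpha> t * (\<Sum>i\<in>(UNIV::'n set). - (G1 * (2 * R)))
        \<le> 2 * \<alpha> t * (\<Sum>i\<in>UNIV. df i t (x i t) \<bullet> (x i t - y))"
      using \<alpha>(1)[OF t] by (intro mult_left_mono) auto
    moreover have "(2 * real CARD('n) * G1\<^sup>2) * (\<alpha> t * \<alpha> t) \<le> (2 * real CARD('n) * G1\<^sup>2) * (\<alpha> 1 * \<alpha> t)"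
      using \<alpha>(1)[OF t] \<alpha>1[OF t] by (intro mult_left_mono mult_right_mono) auto
    ultimately show ?thesis
      using sum_descent[OF t y] by (simp add: algebra_simps power2_eq_square)
  qed
  have "(\<Sum>t=1..T. 3 / 2 * \<gamma>0 * (\<Sum>i\<in>UNIV. (viol i t)\<^sup>2)
      - 2 * \<gamma>0 * (\<Sum>i\<in>UNIV. \<Sum>k<m i. max 0 (g i t (x i t) k) * g i t y k))
    \<le> (\<Sum>t=1..T. (lyap y t - lyap y (Suc t)) + 4 * R * (s t * (\<Sum>j\<in>UNIV. err j t))
      + (2 * real CARD('n) * G1\<^sup>2 * \<alpha> 1 + 4 * real CARD('n) * R * G1) * \<alpha> t)"
    by (intro sum_mono step) auto
  moreover have "(\<Sum>t=1..T. lyap y t - lyap y (Suc t)) \<le> 4 * real CARD('n) * R\<^sup>2"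
  proof (cases "T = 0")
    case False
    then show ?thesis
      using sum_weighted_differences_le[of "lyap y" _ "\<lambda>_. 1" T] lyap_bounds(1)[OF y] lyap_bounds(2) by simp
  qed simp
  ultimately show ?thesis
    by (simp add: sum.distrib sum_subtractf sum_distrib_left)
qed

text \<open>The weight \<open>\<tau>\<close> stays free so that it can later be matched to the
  horizon. The factor \<open>\<tau> / (3 * \<gamma>0)\<close> converts the energy coefficient
  \<open>3 / 2 * \<gamma>0\<close> into the \<open>\<tau> / 2\<close> of Young's inequality.\<close>

lemma sum_viol_le:
  assumes feasible: "feasible_set X m g T \<noteq> {}" and \<tau>: "\<tau> > 0"
  shows "(\<Sum>t=1..T. \<Sum>i\<in>UNIV. viol i t)
    \<le> \<tau> / (3 * \<gamma>0) * (4 * real CARD('n) * R\<^sup>2 + 4 * R * (\<Sum>t=1..T. s t * (\<Sum>j\<in>UNIV. err j t))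
      + (2 * real CARD('n) * G1\<^sup>2 * \<alpha> 1 + 4 * real CARD('n) * R * G1) * (\<Sum>t=1..T. \<alpha> t))
      + real CARD('n) * real T / (2 * \<tau>)" (is "_ \<le> \<tau> / (3 * \<gamma>0) * ?Y + _")
proof -
  obtain y where y: "y \<in> X" "\<And>t i k. t \<in> {1..T} \<Longrightarrow> k < m i \<Longrightarrow> g i t y k \<le> 0"
    using feasible by (auto simp: feasible_set_def)
  have "(\<Sum>t=1..T. \<Sum>i\<in>UNIV. \<Sum>k<m i. max 0 (g i t (x i t) k) * g i t y k) \<le> 0"
    using y(2) by (intro sum_nonpos mult_nonneg_nonpos) auto
  then have "2 * \<gamma>0 * (\<Sum>t=1..T. \<Sum>i\<in>UNIV. \<Sum>k<m i. max 0 (g i t (x i t) k) * g i t y k) \<le> 0"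
    using \<gamma>0 by (intro mult_nonneg_nonpos) auto
  then have "3 / 2 * \<gamma>0 * (\<Sum>t=1..T. \<Sum>i\<in>UNIV. (viol i t)\<^sup>2) \<le> ?Y"
    using sum_viol_energy_le[OF y(1), of T] by linarith
  then have "\<tau> / (3 * \<gamma>0) * (3 / 2 * \<gamma>0 * (\<Sum>t=1..T. \<Sum>i\<in>UNIV. (viol i t)\<^sup>2)) \<le> \<tau> / (3 * \<gamma>0) * ?Y"
    using \<tau> \<gamma>0 by (intro mult_left_mono) auto
  then have energy: "\<tau> / 2 * (\<Sum>t=1..T. \<Sum>i\<in>UNIV. (viol i t)\<^sup>2) \<le> \<tau> / (3 * \<gamma>0) * ?Y"
    using \<gamma>0 by simp
  have "viol i t \<le> \<tau> / 2 * (viol i t)\<^sup>2 + 1 / (2 * \<tau>)" for i t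
    using \<tau> sum_squares_bound[of "\<tau> * viol i t" 1] by (simp add: field_simps power2_eq_square)
  then have "(\<Sum>t=1..T. \<Sum>i\<in>UNIV. viol i t)
      \<le> (\<Sum>t=1..T. \<Sum>i\<in>(UNIV::'n set). \<tau> / 2 * (viol i t)\<^sup>2 + 1 / (2 * \<tau>))"
    by (intro sum_mono)
  also have "\<dots> = \<tau> / 2 * (\<Sum>t=1..T. \<Sum>i\<in>UNIV. (viol i t)\<^sup>2) + real CARD('n) * real T / (2 * \<tau>)"
    by (simp add: sum.distrib sum_distrib_left)
  finally show ?thesis using energy by linarith
qed

lemma slater_sum_viol_le:
  assumes y: "y \<in> X" and \<zeta>: "\<zeta> > 0" "\<And>t i k. t \<ge> 1 \<Longrightarrow> k < m i \<Longrightarrow> g i t y k \<le> - \<zeta>"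
  shows "(\<Sum>t=1..T. \<Sum>i\<in>UNIV. viol i t)
    \<le> 1 / (2 * \<gamma>0 * \<zeta>) * (4 * real CARD('n) * R\<^sup>2 + 4 * R * (\<Sum>t=1..T. s t * (\<Sum>j\<in>UNIV. err j t))
      + (2 * real CARD('n) * G1\<^sup>2 * \<alpha> 1 + 4 * real CARD('n) * R * G1) * (\<Sum>t=1..T. \<alpha> t))"
    (is "_ \<le> _ * ?Y")
proof -
  have "(\<Sum>k<m i. max 0 (g i t (x i t) k) * g i t y k) \<le> - (\<zeta> * viol i t)" if "t \<ge> 1" for i t
  proof -
    have "(\<Sum>k<m i. max 0 (g i t (x i t) k) * g i t y k) \<le> (\<Sum>k<m i. max 0 (g i t (x i t) k) * (- \<zeta>))"
      using \<zeta>(2)[OF that] by (intro sum_mono mult_left_mono) auto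
    also have "\<dots> = \<zeta> * - (\<Sum>k<m i. max 0 (g i t (x i t) k))"
      by (simp add: sum_negf sum_distrib_left mult_ac)
    also have "\<dots> \<le> \<zeta> * - viol i t"
      using \<zeta>(1) unfolding viol_def by (intro mult_left_mono) (auto intro!: L2_set_le_sum)
    finally show ?thesis by simp
  qed
  then have "(\<Sum>t=1..T. \<Sum>i\<in>UNIV. \<Sum>k<m i. max 0 (g i t (x i t) k) * g i t y k)
      \<le> (\<Sum>t=1..T. \<Sum>i\<in>UNIV. - (\<zeta> * viol i t))"
    by (intro sum_mono) auto
  also have "\<dots> = - (\<zeta> * (\<Sum>t=1..T. \<Sum>i\<in>UNIV. viol i t))"
    by (simp add: sum_negf sum_distrib_left)
  finally have "2 * \<gamma>0 * (\<Sum>t=1..T. \<Sum>i\<in>UNIV. \<Sum>k<m i. max 0 (g i t (x i t) k) * g i t y k)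
      \<le> 2 * \<gamma>0 * - (\<zeta> * (\<Sum>t=1..T. \<Sum>i\<in>UNIV. viol i t))"
    using \<gamma>0 by (intro mult_left_mono) auto
  moreover have "0 \<le> 3 / 2 * \<gamma>0 * (\<Sum>t=1..T. \<Sum>i\<in>UNIV. (viol i t)\<^sup>2)"
    using \<gamma>0 by (intro mult_nonneg_nonneg sum_nonneg) auto
  ultimately have "2 * \<gamma>0 * \<zeta> * (\<Sum>t=1..T. \<Sum>i\<in>UNIV. viol i t) \<le> ?Y"
    using sum_viol_energy_le[OF y(1), of T] by linarith
  then show ?thesis
    using \<gamma>0 \<zeta> by (simp add: pos_le_divide_eq mult_ac)
qed

lemma net_ccv_le:
  "net_ccv m g x T \<le> (\<Sum>t=1..T. \<Sum>i\<in>UNIV. viol i t) + real CARD('n) * G2 * (\<Sum>t=1..T. diam (\<lambda>i. x i t))"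
proof -
  have local_le: "L2_set (\<lambda>k. max 0 (g j t (x i t) k)) {..<m j} \<le> viol j t + G2 * diam (\<lambda>i. x i t)"
    if t: "t \<ge> 1" for i j t
  proof -
    \<comment> \<open>The subgradient is taken at \<open>x i t\<close>, the point where agent
      \<open>j\<close>'s constraint is evaluated for agent \<open>i\<close>; this bounds the excess
      over the violation at agent \<open>j\<close>'s own decision.\<close>
    have "L2_set (\<lambda>k. max 0 (g j t (x i t) k)) {..<m j}
        \<le> L2_set (\<lambda>k. max 0 (g j t (x j t) k) + \<bar>dg j t (x i t) k \<bullet> (x i t - x j t)\<bar>) {..<m j}"
      using g_subgradient[OF t _ x_in[OF t], of _ j i] x_in[OF t, of j]
      by (intro L2_set_mono) (fastforce simp: subgradient_on_def inner_diff_right)+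
    also have "\<dots> \<le> viol j t + L2_set (\<lambda>k. \<bar>dg j t (x i t) k \<bullet> (x i t - x j t)\<bar>) {..<m j}"
      unfolding viol_def by (rule L2_set_triangle_ineq)
    also have "L2_set (\<lambda>k. \<bar>dg j t (x i t) k \<bullet> (x i t - x j t)\<bar>) {..<m j}
        = L2_set (\<lambda>k. dg j t (x i t) k \<bullet> (x i t - x j t)) {..<m j}"
      by (simp add: L2_set_def)
    also have "\<dots> \<le> row_onorm (m j) (dg j t (x i t)) * norm (x i t - x j t)"
      by (rule L2_set_le_row_onorm)
    also have "\<dots> \<le> G2 * diam (\<lambda>i. x i t)"
      using G_nonneg norm_diff_le_diam[of "\<lambda>i. x i t" i j]
      by (intro mult_mono g_bound t x_in) auto
    finally show ?thesis by simp
  qed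
  have "(\<Sum>t=1..T. L2_set (\<lambda>(j, k). max 0 (g j t (x i t) k)) (SIGMA j:UNIV. {..<m j}))
      \<le> (\<Sum>t=1..T. \<Sum>j\<in>UNIV. viol j t + G2 * diam (\<lambda>i. x i t))" for i
    by (intro sum_mono order_trans[OF L2_set_Sigma_le] local_le) auto
  then have "net_ccv m g x T \<le> (1 / real CARD('n)) *
      (\<Sum>i\<in>(UNIV::'n set). \<Sum>t=1..T. \<Sum>j\<in>(UNIV::'n set). viol j t + G2 * diam (\<lambda>i. x i t))"
    unfolding net_ccv_def by (intro mult_left_mono, intro sum_mono[where K = UNIV]) auto
  then show ?thesis by (simp add: sum.distrib sum_distrib_left mult_ac)
qed

text \<open>The regret of agent \<open>i\<close> uses all gradients at its own decision, whereas the
  descent inequality knows each gradient only at its owner's decision. The exchange costs a multiple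
  of the disagreement, whose sum brings in the violations; these are absorbed round by
  round.\<close>

lemma net_reg_le:
  assumes feasible: "feasible_set X m g T \<noteq> {}" and T: "T \<ge> 1"
  defines "A \<equiv> (2 * R * \<bar>L\<bar> + G1) * mixing_const CARD('n) B w"
  shows "net_reg X m df g x T \<le> 2 * R\<^sup>2 / \<alpha> T + A * R
    + (G1\<^sup>2 + (real CARD('n) * A * G2)\<^sup>2 * \<gamma>0 / 3 + A * real CARD('n) * G1) * (\<Sum>t=1..T. \<alpha> t)
    + (\<Sum>t=1..T. (2 * R / (real CARD('n) * \<alpha> t) + A) * (s t * (\<Sum>j\<in>UNIV. err j t)))" (is "_ \<le> ?rhs")
proof -
  let ?n = "real CARD('n)"
  have A: "0 \<le> A" unfolding A_def
    using R_nonneg G_nonneg mixing_const_nonneg by (intro mult_nonneg_nonneg add_nonneg_nonneg) auto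
  have "(\<Sum>t=1..T. avg_grad df t (x i t) \<bullet> x i t)
      - (INF y\<in>feasible_set X m g T. (\<Sum>t=1..T. avg_grad df t (x i t)) \<bullet> y) \<le> ?rhs" for i
  proof -
    have main: "(\<Sum>t=1..T. avg_grad df t (x i t) \<bullet> (x i t - y)) \<le> ?rhs"
      if "y \<in> feasible_set X m g T" for y
    proof -
      have y: "y \<in> X" "\<And>t i k. t \<in> {1..T} \<Longrightarrow> k < m i \<Longrightarrow> g i t y k \<le> 0"
        using that by (auto simp: feasible_set_def)
      \<comment> \<open>Two replacements: the gradient moves from \<open>x i t\<close> to
        \<open>x j t\<close> by the Lipschitz bound, the decision by the gradient bound.
        \<open>L\<close> may be negative, hence its absolute value.\<close>
      have drift: "avg_grad df t (x i t) \<bullet> (x i t - y)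
          \<le> (1 / ?n) * (\<Sum>j\<in>UNIV. df j t (x j t) \<bullet> (x j t - y)) + (2 * R * \<bar>L\<bar> + G1) * diam (\<lambda>i. x i t)"
        if t: "t \<ge> 1" for t
      proof -
        let ?D = "diam (\<lambda>i. x i t)"
        have "df j t (x i t) \<bullet> (x i t - y) \<le> df j t (x j t) \<bullet> (x j t - y) + (2 * R * \<bar>L\<bar> + G1) * ?D" for j
        proof -
          have D: "norm (x i t - x j t) \<le> ?D" by (rule norm_diff_le_diam)
          have "norm (df j t (x i t) - df j t (x j t)) \<le> L * norm (x i t - x j t)"
            by (intro f_Lipschitz x_in t)
          also have "\<dots> \<le> \<bar>L\<bar> * ?D"
            using D by (intro mult_mono) auto
          finally have "(df j t (x i t) - df j t (x j t)) \<bullet> (x i t - y) \<le> (\<bar>L\<bar> * ?D) * (2 * R)"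
            using norm_diff_le[OF x_in[OF t] y(1), of i]
            by (intro order_trans[OF norm_cauchy_schwarz] mult_mono) (auto simp: diam_nonneg)
          moreover have "df j t (x j t) \<bullet> (x i t - x j t) \<le> G1 * ?D"
            using D G_nonneg by (intro order_trans[OF norm_cauchy_schwarz] mult_mono f_bound t x_in) auto
          ultimately show ?thesis
            by (simp add: inner_diff_left inner_diff_right algebra_simps)
        qed
        then have "(\<Sum>j\<in>UNIV. df j t (x i t) \<bullet> (x i t - y))
            \<le> (\<Sum>j\<in>UNIV. df j t (x j t) \<bullet> (x j t - y) + (2 * R * \<bar>L\<bar> + G1) * ?D)"
          by (intro sum_mono)
        then have "(1 / ?n) * (\<Sum>j\<in>UNIV. df j t (x i t) \<bullet> (x i t - y))
            \<le> (1 / ?n) * (\<Sum>j\<in>UNIV. df j t (x j t) \<bullet> (x j t - y) + (2 * R * \<bar>L\<bar> + G1) * ?D)"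
          by (intro mult_left_mono) auto
        then show ?thesis
          by (simp add: avg_grad_def inner_sum_left sum.distrib add_divide_distrib)
      qed
      \<comment> \<open>Division by \<open>2 * \<alpha> t\<close> and averaging over the agents in
        one factor. It grows with \<open>t\<close> because the step sizes do not increase, as Abel
        summation requires.\<close>
      define c where "c t = 1 / (2 * ?n * \<alpha> t)" for t
      define e where "e t = s t * (\<Sum>j\<in>UNIV. err j t)" for t
      have local_regret: "(1 / ?n) * (\<Sum>j\<in>UNIV. df j t (x j t) \<bullet> (x j t - y)) + A * G2 * \<gamma>0 * (\<Sum>i\<in>UNIV. viol i t)
          \<le> c t * (lyap y t - lyap y (Suc t)) + 2 * R / (?n * \<alpha> t) * e t
            + (G1\<^sup>2 + (?n * A * G2)\<^sup>2 * \<gamma>0 / 3) * \<alpha> t" if t: "t \<in> {1..T}" for t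
      proof -
        have t1: "t \<ge> 1" and \<alpha>t: "\<alpha> t > 0" using t \<alpha>(1) by auto
        \<comment> \<open>The weight in Young's inequality is chosen so that the quadratic
          coefficient equals \<open>c t * (3 / 2 * \<gamma>0)\<close>, exactly what the divided
          descent inequality offers.\<close>
        have young: "A * G2 * \<gamma>0 * b \<le> 3 * \<gamma>0 / (4 * ?n * \<alpha> t) * b\<^sup>2 + ?n * (A * G2)\<^sup>2 * \<gamma>0 / 3 * \<alpha> t" for b
        proof -
          have "2 * (3 * b) * (2 * ?n * \<alpha> t * A * G2) \<le> (3 * b)\<^sup>2 + (2 * ?n * \<alpha> t * A * G2)\<^sup>2"
            by (rule sum_squares_bound)
          then have "\<gamma>0 / (12 * ?n * \<alpha> t) * (2 * (3 * b) * (2 * ?n * \<alpha> t * A * G2))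
              \<le> \<gamma>0 / (12 * ?n * \<alpha> t) * ((3 * b)\<^sup>2 + (2 * ?n * \<alpha> t * A * G2)\<^sup>2)"
            using \<gamma>0 \<alpha>t by (intro mult_left_mono) auto
          then show ?thesis
            using \<alpha>t by (simp add: field_simps power2_eq_square)
        qed
        have "(\<Sum>i\<in>UNIV. A * G2 * \<gamma>0 * viol i t)
            \<le> (\<Sum>i\<in>(UNIV::'n set). 3 * \<gamma>0 / (4 * ?n * \<alpha> t) * (viol i t)\<^sup>2 + ?n * (A * G2)\<^sup>2 * \<gamma>0 / 3 * \<alpha> t)"
          by (intro sum_mono young)
        then have viol_le: "A * G2 * \<gamma>0 * (\<Sum>i\<in>UNIV. viol i t)
            \<le> 3 * \<gamma>0 / (4 * ?n * \<alpha> t) * (\<Sum>i\<in>UNIV. (viol i t)\<^sup>2) + (?n * A * G2)\<^sup>2 * \<gamma>0 / 3 * \<alpha> t"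
          by (simp add: sum.distrib sum_distrib_left sum_divide_distrib power2_eq_square mult_ac)
        have "(\<Sum>i\<in>UNIV. \<Sum>k<m i. max 0 (g i t (x i t) k) * g i t y k) \<le> 0"
          using y(2)[OF t] by (intro sum_nonpos mult_nonneg_nonpos) auto
        then have "2 * \<gamma>0 * (\<Sum>i\<in>UNIV. \<Sum>k<m i. max 0 (g i t (x i t) k) * g i t y k) \<le> 0"
          using \<gamma>0 by (intro mult_nonneg_nonpos) auto
        then have "2 * \<alpha> t * (\<Sum>i\<in>UNIV. df i t (x i t) \<bullet> (x i t - y)) + 3 / 2 * \<gamma>0 * (\<Sum>i\<in>UNIV. (viol i t)\<^sup>2)
            \<le> lyap y t - lyap y (Suc t) + 4 * R * e t + 2 * ?n * G1\<^sup>2 * (\<alpha> t)\<^sup>2"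
          using sum_descent[OF t1 y(1)] by (simp add: e_def)
        then have "c t * (2 * \<alpha> t * (\<Sum>i\<in>UNIV. df i t (x i t) \<bullet> (x i t - y)) + 3 / 2 * \<gamma>0 * (\<Sum>i\<in>UNIV. (viol i t)\<^sup>2))
            \<le> c t * (lyap y t - lyap y (Suc t) + 4 * R * e t + 2 * ?n * G1\<^sup>2 * (\<alpha> t)\<^sup>2)"
          using \<alpha>t by (intro mult_left_mono) (auto simp: c_def)
        moreover have "c t * (2 * \<alpha> t * a + 3 / 2 * \<gamma>0 * b) = 1 / ?n * a + 3 * \<gamma>0 / (4 * ?n * \<alpha> t) * b" for a b
          using \<alpha>t by (simp add: c_def field_simps)
        moreover have "c t * (l + 4 * R * e t + 2 * ?n * G1\<^sup>2 * (\<alpha> t)\<^sup>2)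
            = c t * l + 2 * R / (?n * \<alpha> t) * e t + G1\<^sup>2 * \<alpha> t" for l
          using \<alpha>t by (simp add: c_def field_simps power2_eq_square)
        ultimately show ?thesis
          using viol_le by (simp add: distrib_right)
      qed
      have telescope: "(\<Sum>t=1..T. c t * (lyap y t - lyap y (Suc t))) \<le> (4 * ?n * R\<^sup>2) * c T"
      proof (rule sum_weighted_differences_le)
        fix t :: nat assume t: "t \<ge> 1"
        show "c t \<le> c (Suc t)"
          unfolding c_def using \<alpha>[OF t] \<alpha>(1)[of "Suc t"] by (intro divide_left_mono) auto
        show "0 \<le> c t" using \<alpha>(1)[OF t] by (simp add: c_def)
      qed (use lyap_bounds(1)[OF y(1)] lyap_bounds(2) T in auto)
      have "(\<Sum>t=1..T. avg_grad df t (x i t) \<bullet> (x i t - y))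
          \<le> (\<Sum>t=1..T. (1 / ?n) * (\<Sum>j\<in>UNIV. df j t (x j t) \<bullet> (x j t - y))
              + (2 * R * \<bar>L\<bar> + G1) * diam (\<lambda>i. x i t))"
        by (intro sum_mono drift) auto
      also have "\<dots> = (\<Sum>t=1..T. (1 / ?n) * (\<Sum>j\<in>UNIV. df j t (x j t) \<bullet> (x j t - y)))
          + (2 * R * \<bar>L\<bar> + G1) * (\<Sum>t=1..T. diam (\<lambda>i. x i t))"
        by (simp add: sum.distrib sum_distrib_left)
      also have "\<dots> \<le> (\<Sum>t=1..T. (1 / ?n) * (\<Sum>j\<in>UNIV. df j t (x j t) \<bullet> (x j t - y)))
          + (2 * R * \<bar>L\<bar> + G1) * (mixing_const CARD('n) B w * (R + (\<Sum>t=1..T. e t)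
            + ?n * G1 * (\<Sum>t=1..T. \<alpha> t) + G2 * \<gamma>0 * (\<Sum>t=1..T. \<Sum>i\<in>UNIV. viol i t)))"
        unfolding e_def using R_nonneg G_nonneg
        by (intro add_left_mono mult_left_mono sum_diam_x_le) auto
      also have "\<dots> = (\<Sum>t=1..T. (1 / ?n) * (\<Sum>j\<in>UNIV. df j t (x j t) \<bullet> (x j t - y))
            + A * G2 * \<gamma>0 * (\<Sum>i\<in>UNIV. viol i t))
          + A * R + A * (\<Sum>t=1..T. e t) + A * ?n * G1 * (\<Sum>t=1..T. \<alpha> t)"
        unfolding A_def[symmetric] mult.assoc[symmetric]
        by (simp add: sum.distrib distrib_left mult_ac flip: sum_distrib_left)
      also have "\<dots> \<le> (\<Sum>t=1..T. c t * (lyap y t - lyap y (Suc t)) + 2 * R / (?n * \<alpha> t) * e t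
            + (G1\<^sup>2 + (?n * A * G2)\<^sup>2 * \<gamma>0 / 3) * \<alpha> t)
          + A * R + A * (\<Sum>t=1..T. e t) + A * ?n * G1 * (\<Sum>t=1..T. \<alpha> t)"
        by (intro add_right_mono sum_mono local_regret)
      also have "\<dots> = (\<Sum>t=1..T. c t * (lyap y t - lyap y (Suc t))) + A * R
          + (G1\<^sup>2 + (?n * A * G2)\<^sup>2 * \<gamma>0 / 3 + A * ?n * G1) * (\<Sum>t=1..T. \<alpha> t)
          + (\<Sum>t=1..T. (2 * R / (?n * \<alpha> t) + A) * e t)"
        by (simp only: sum.distrib distrib_right sum_distrib_left)
      also have "\<dots> \<le> (4 * ?n * R\<^sup>2) * c T + A * R
          + (G1\<^sup>2 + (?n * A * G2)\<^sup>2 * \<gamma>0 / 3 + A * ?n * G1) * (\<Sum>t=1..T. \<alpha> t)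
          + (\<Sum>t=1..T. (2 * R / (?n * \<alpha> t) + A) * e t)"
        using telescope by (intro add_right_mono)
      also have "(4 * ?n * R\<^sup>2) * c T = 2 * R\<^sup>2 / \<alpha> T"
        by (simp add: c_def)
      finally show ?thesis by (simp add: e_def)
    qed
    \<comment> \<open>The bound holds for every comparator with the same right-hand side; solved for
      the comparator it becomes a lower bound of the infimum, so no minimizer is chosen.\<close>
    have "(\<Sum>t=1..T. avg_grad df t (x i t) \<bullet> x i t) - ?rhs
        \<le> (INF y\<in>feasible_set X m g T. (\<Sum>t=1..T. avg_grad df t (x i t)) \<bullet> y)"
    proof (rule cINF_greatest[OF feasible])
      fix y assume "y \<in> feasible_set X m g T"
      from main[OF this] show "(\<Sum>t=1..T. avg_grad df t (x i t) \<bullet> x i t) - ?rhs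
          \<le> (\<Sum>t=1..T. avg_grad df t (x i t)) \<bullet> y"
        by (simp add: inner_diff_right sum_subtractf inner_sum_left)
    qed
    then show ?thesis by linarith
  qed
  then have "(\<Sum>i\<in>UNIV. (\<Sum>t=1..T. avg_grad df t (x i t) \<bullet> x i t)
      - (INF y\<in>feasible_set X m g T. (\<Sum>t=1..T. avg_grad df t (x i t)) \<bullet> y)) \<le> (\<Sum>i\<in>(UNIV::'n set). ?rhs)"
    by (intro sum_mono)
  then show ?thesis
    unfolding net_reg_def by (simp add: pos_divide_le_eq mult.commute)
qed

section \<open>Continuity in the decision, as a source of measurability\<close>

lemma continuous_on_df:
  assumes "t \<ge> 1"
  shows "continuous_on X (df i t)"
proof -
  have "\<bar>L\<bar>-lipschitz_on X (df i t)"
  proof (rule lipschitz_onI)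
    fix y y' assume "y \<in> X" "y' \<in> X"
    then have "norm (df i t y - df i t y') \<le> L * norm (y - y')"
      by (rule f_Lipschitz[OF assms])
    also have "\<dots> \<le> \<bar>L\<bar> * norm (y - y')" by (intro mult_right_mono) auto
    finally show "dist (df i t y) (df i t y') \<le> \<bar>L\<bar> * dist y y'" by (simp add: dist_norm)
  qed simp
  then show ?thesis by (rule lipschitz_on_continuous_on)
qed

text \<open>The subgradient at \<open>y\<close> bounds \<open>g y - g y'\<close> from above, and
  exchanging the two points gives the Lipschitz bound. A single entry is dominated by the norm of
  all entries, so the operator norm bound applies.\<close>

lemma continuous_on_g:
  assumes t: "t \<ge> 1" and k: "k < m i"
  shows "continuous_on X (\<lambda>y. g i t y k)"
proof -
  have le: "g i t y k - g i t y' k \<le> G2 * norm (y - y')" if y: "y \<in> X" "y' \<in> X" for y y'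
  proof -
    have "g i t y k - g i t y' k \<le> dg i t y k \<bullet> (y - y')"
      using g_subgradient[OF t k y(1)] y(2) by (auto simp: subgradient_on_def inner_diff_right)
    also have "\<dots> \<le> L2_set (\<lambda>k. dg i t y k \<bullet> (y - y')) {..<m i}"
    proof -
      have "dg i t y k \<bullet> (y - y') \<le> sqrt ((dg i t y k \<bullet> (y - y'))\<^sup>2)" by simp
      also have "\<dots> \<le> L2_set (\<lambda>k. dg i t y k \<bullet> (y - y')) {..<m i}"
        unfolding L2_set_def using k by (intro real_sqrt_le_mono member_le_sum) auto
      finally show ?thesis .
    qed
    also have "\<dots> \<le> row_onorm (m i) (dg i t y) * norm (y - y')"
      by (rule L2_set_le_row_onorm)
    also have "\<dots> \<le> G2 * norm (y - y')"
      by (intro mult_right_mono g_bound t y) auto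
    finally show ?thesis .
  qed
  have "G2-lipschitz_on X (\<lambda>y. g i t y k)"
    using le G_nonneg by (intro lipschitz_onI) (force simp: dist_norm abs_le_iff norm_minus_commute)+
  then show ?thesis by (rule lipschitz_on_continuous_on)
qed

end

section \<open>Measurability and expectations\<close>

text \<open>The freezing lemma: \<open>U\<close> is a function of the history and \<open>Y\<close>
  is independent of it, so the pair has a product law, and Tonelli integrates the draw with
  \<open>U\<close> held fixed.\<close>

lemma (in prob_space) nn_integral_fresh:
  assumes H: "H \<in> measurable M N" and Y: "Y \<in> measurable M Q"
    and law: "distr M Q Y = Q" and Q: "prob_space Q"
    and indep: "indep_set {Y -` A \<inter> space M | A. A \<in> sets Q} {H -` A \<inter> space M | A. A \<in> sets N}"
    and U: "U \<in> measurable (vimage_algebra (space M) H N) K"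
    and \<phi>: "\<phi> \<in> borel_measurable (K \<Otimes>\<^sub>M Q)"
  shows "(\<integral>\<^sup>+ \<omega>. \<phi> (U \<omega>, Y \<omega>) \<partial>M) = (\<integral>\<^sup>+ \<omega>. (\<integral>\<^sup>+ r. \<phi> (U \<omega>, r) \<partial>Q) \<partial>M)"
proof -
  interpret Q: prob_space Q by (rule Q)
  have "(\<lambda>\<omega>. \<omega>) \<in> measurable M (vimage_algebra (space M) H N)"
    using H by (intro measurable_vimage_algebra2) auto
  then have UM: "U \<in> measurable M K"
    using U by (rule measurable_compose)
  interpret D: prob_space "distr M K U" by (rule prob_space_distr[OF UM])
  have UY: "(\<lambda>\<omega>. (U \<omega>, Y \<omega>)) \<in> measurable M (K \<Otimes>\<^sub>M Q)"
    using UM Y by (rule measurable_Pair)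
  \<comment> \<open>Equality of the laws is tested on rectangles. There independence applies because
    the sets of the generated sigma-algebra are exactly the preimages under
    \<open>H\<close>.\<close>
  have joint: "distr M K U \<Otimes>\<^sub>M Q = distr M (K \<Otimes>\<^sub>M Q) (\<lambda>\<omega>. (U \<omega>, Y \<omega>))"
  proof (rule pair_measure_eqI)
    show "sigma_finite_measure (distr M K U)" "sigma_finite_measure Q" by unfold_locales
    show "sets (distr M K U \<Otimes>\<^sub>M Q) = sets (distr M (K \<Otimes>\<^sub>M Q) (\<lambda>\<omega>. (U \<omega>, Y \<omega>)))"
      by (simp cong: sets_pair_measure_cong)
    fix A' A assume A': "A' \<in> sets (distr M K U)" and A: "A \<in> sets Q"
    have "U -` A' \<inter> space M \<in> sets (vimage_algebra (space M) H N)"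
      using measurable_sets[OF U, of A'] A' by simp
    then have "U -` A' \<inter> space M \<in> {H -` A \<inter> space M | A. A \<in> sets N}"
      using measurable_space[OF H] by (subst (asm) sets_vimage_algebra2) auto
    moreover have "Y -` A \<inter> space M \<in> {Y -` A \<inter> space M | A. A \<in> sets Q}"
      using A by auto
    ultimately have "prob ((Y -` A \<inter> space M) \<inter> (U -` A' \<inter> space M))
        = prob (Y -` A \<inter> space M) * prob (U -` A' \<inter> space M)"
      using indep_setD[OF indep] by blast
    moreover have "(\<lambda>\<omega>. (U \<omega>, Y \<omega>)) -` (A' \<times> A) \<inter> space M
        = (Y -` A \<inter> space M) \<inter> (U -` A' \<inter> space M)"
      by auto
    moreover have "emeasure Q A = emeasure M (Y -` A \<inter> space M)"
      using A Y by (subst law[symmetric]) (simp add: emeasure_distr)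
    ultimately show "emeasure (distr M K U) A' * emeasure Q A
        = emeasure (distr M (K \<Otimes>\<^sub>M Q) (\<lambda>\<omega>. (U \<omega>, Y \<omega>))) (A' \<times> A)"
      using A A' UM UY
      by (simp add: emeasure_distr emeasure_eq_measure mult.commute flip: ennreal_mult)
  qed
  have "sets (distr M K U \<Otimes>\<^sub>M Q) = sets (K \<Otimes>\<^sub>M Q)"
    by (intro sets_pair_measure_cong) auto
  then have \<phi>': "\<phi> \<in> borel_measurable (distr M K U \<Otimes>\<^sub>M Q)"
    using \<phi> measurable_cong_sets by blast
  have "(\<integral>\<^sup>+ \<omega>. \<phi> (U \<omega>, Y \<omega>) \<partial>M) = (\<integral>\<^sup>+ q. \<phi> q \<partial>distr M (K \<Otimes>\<^sub>M Q) (\<lambda>\<omega>. (U \<omega>, Y \<omega>)))"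
    using UY \<phi> by (simp add: nn_integral_distr)
  also have "\<dots> = (\<integral>\<^sup>+ u. (\<integral>\<^sup>+ r. \<phi> (u, r) \<partial>Q) \<partial>distr M K U)"
    unfolding joint[symmetric] by (rule Q.nn_integral_fst[symmetric, OF \<phi>'])
  also have "\<dots> = (\<integral>\<^sup>+ \<omega>. (\<integral>\<^sup>+ r. \<phi> (U \<omega>, r) \<partial>Q) \<partial>M)"
    using UM \<phi>' by (intro nn_integral_distr Q.borel_measurable_nn_integral_fst)
  finally show ?thesis .
qed

text \<open>An infimum of uniformly Lipschitz linear functionals is Lipschitz. This makes the
  infimum in the regret measurable although it ranges over a possibly uncountable set; comparison
  with \<open>q = 0\<close> gives the growth bound.\<close>

lemma continuous_on_cINF_inner:
  fixes S :: "'a::real_inner set"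
  assumes S: "S \<noteq> {}" "\<And>y. y \<in> S \<Longrightarrow> norm y \<le> R"
  shows "continuous_on UNIV (\<lambda>q. INF y\<in>S. q \<bullet> y)"
    and "\<bar>INF y\<in>S. q \<bullet> y\<bar> \<le> R * norm q"
proof -
  have abs_le: "\<bar>q \<bullet> y\<bar> \<le> R * norm q" if "y \<in> S" for q y
    using order_trans[OF Cauchy_Schwarz_ineq2 mult_left_mono[OF S(2)[OF that]], of q]
    by (simp add: mult.commute)
  have bdd: "bdd_below ((\<lambda>y. q \<bullet> y) ` S)" for q
  proof (rule bdd_belowI2)
    fix y assume "y \<in> S"
    from abs_le[OF this, of q] show "- (R * norm q) \<le> q \<bullet> y" by linarith
  qed
  have le: "(INF y\<in>S. q \<bullet> y) - R * norm (q - q') \<le> (INF y\<in>S. q' \<bullet> y)" for q q'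
  proof (rule cINF_greatest[OF S(1)])
    fix y assume y: "y \<in> S"
    have "(INF y\<in>S. q \<bullet> y) \<le> q \<bullet> y" by (rule cINF_lower[OF bdd y])
    then show "(INF y\<in>S. q \<bullet> y) - R * norm (q - q') \<le> q' \<bullet> y"
      using abs_le[OF y, of "q - q'"] by (simp add: inner_diff_left)
  qed
  obtain y0 where "y0 \<in> S" using S(1) by auto
  then have "R \<ge> 0" using S(2) norm_ge_zero order_trans by blast
  then have "R-lipschitz_on UNIV (\<lambda>q. INF y\<in>S. q \<bullet> y)"
  proof (intro lipschitz_onI)
    fix q q'
    show "dist (INF y\<in>S. q \<bullet> y) (INF y\<in>S. q' \<bullet> y) \<le> R * dist q q'"
      using le[of q q'] le[of q' q] by (simp add: dist_norm abs_le_iff norm_minus_commute)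
  qed
  then show "continuous_on UNIV (\<lambda>q. INF y\<in>S. q \<bullet> y)"
    by (rule lipschitz_on_continuous_on)
  show "\<bar>INF y\<in>S. q \<bullet> y\<bar> \<le> R * norm q"
    using le[of q 0] le[of 0 q] S(1) by (simp add: abs_le_iff)
qed

text \<open>The trajectories are arbitrary functions of the outcome that satisfy the recursion on
  \<open>space M\<close>; their measurability is derived. The loss gradients and constraints are
  continuous on X, but a choice of constraint subgradients need not be, hence
  \<open>g_measurable\<close>.\<close>

locale random_run = prob_space M + Q: prob_space Q
  for M :: "'w measure" and Q :: "'r measure" +
  fixes X :: "(real ^ 'p) set"
    and m :: "'n::finite \<Rightarrow> nat"
    and df :: "'n \<Rightarrow> nat \<Rightarrow> real ^ 'p \<Rightarrow> real ^ 'p"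
    and g :: "'n \<Rightarrow> nat \<Rightarrow> real ^ 'p \<Rightarrow> nat \<Rightarrow> real"
    and dg :: "'n \<Rightarrow> nat \<Rightarrow> real ^ 'p \<Rightarrow> nat \<Rightarrow> real ^ 'p"
    and E :: "nat \<Rightarrow> ('n \<times> 'n) set"
    and W :: "nat \<Rightarrow> real ^ 'n ^ 'n"
    and B :: nat
    and \<alpha> \<gamma> s :: "nat \<Rightarrow> real"
    and z1 :: "'n \<Rightarrow> real ^ 'p"
    and \<xi> :: "'n \<Rightarrow> nat \<Rightarrow> 'w \<Rightarrow> 'r"
    and Comp :: "real ^ 'p \<Rightarrow> 'r \<Rightarrow> real ^ 'p"
    and zh z x om :: "'w \<Rightarrow> 'n \<Rightarrow> nat \<Rightarrow> real ^ 'p"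
    and v :: "'w \<Rightarrow> 'n \<Rightarrow> nat \<Rightarrow> nat \<Rightarrow> real"
    and R G1 G2 L w \<gamma>0 C :: real
  assumes pathwise: "\<And>\<omega>. \<omega> \<in> space M \<Longrightarrow> compressed_run X m df g dg E W B \<alpha> \<gamma> s z1
          (\<lambda>j t u. Comp u (\<xi> j t \<omega>)) (zh \<omega>) (z \<omega>) (x \<omega>) (om \<omega>) (v \<omega>) R G1 G2 L w \<gamma>0"
    and g_measurable: "\<And>i t k. t \<ge> 1 \<Longrightarrow> k < m i \<Longrightarrow>
          (\<lambda>y. dg i t y k) \<in> borel_measurable (restrict_space borel X)"
    and fresh: "fresh_randomness M Q \<xi>"
    and Comp_measurable: "case_prod Comp \<in> borel_measurable (borel \<Otimes>\<^sub>M Q)"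
    and C: "C \<ge> 0" "\<And>u. (\<integral>\<^sup>+ r. ennreal ((norm (Comp u r - u))\<^sup>2) \<partial>Q) \<le> ennreal C"
    and feasible: "\<And>T. T \<ge> 1 \<Longrightarrow> feasible_set X m g T \<noteq> {}"
begin

section \<open>Adaptedness of the trajectories and moments of the compression error\<close>

definition comp_err :: "'n \<Rightarrow> nat \<Rightarrow> 'w \<Rightarrow> real" where
  "comp_err j t \<omega> = compressed_run.err s (\<lambda>j t u. Comp u (\<xi> j t \<omega>)) (zh \<omega>) (z \<omega>) j t"

definition history :: "nat \<Rightarrow> 'w \<Rightarrow> 'n \<times> nat \<Rightarrow> 'r" where
  "history t = (\<lambda>\<omega>. \<lambda>(i, l)\<in>UNIV \<times> {1..<t}. \<xi> i l \<omega>)"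

text \<open>The sigma-algebra of all draws strictly before \<open>t\<close>. For
  \<open>t = 1\<close> the index set is empty and the sigma-algebra is trivial.\<close>

definition past :: "nat \<Rightarrow> 'w measure" where
  "past t = vimage_algebra (space M) (history t) (PiM (UNIV \<times> {1..<t}) (\<lambda>_. Q))"

lemma space_past [simp]: "space (past t) = space M"
  by (simp add: past_def)

lemma \<xi>_measurable: "t \<ge> 1 \<Longrightarrow> \<xi> j t \<in> measurable M Q"
  using fresh by (auto simp: fresh_randomness_def)

lemma history_measurable:
  assumes "\<And>i l. 1 \<le> l \<Longrightarrow> l < t \<Longrightarrow> \<xi> i l \<in> measurable N Q"
  shows "history t \<in> measurable N (PiM (UNIV \<times> {1..<t}) (\<lambda>_. Q))"
  unfolding history_def using assms by (intro measurable_restrict) auto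

lemma \<xi>_measurable_past:
  assumes "1 \<le> l" "l < t"
  shows "\<xi> i l \<in> measurable (past t) Q"
proof -
  have "history t \<in> measurable (past t) (PiM (UNIV \<times> {1..<t}) (\<lambda>_. Q))"
    unfolding past_def using measurable_space[OF history_measurable[OF \<xi>_measurable]]
    by (intro measurable_vimage_algebra1) auto
  then have "(\<lambda>\<omega>. history t \<omega> (i, l)) \<in> measurable (past t) Q"
    by (rule measurable_compose) (use assms in \<open>auto intro!: measurable_component_singleton\<close>)
  then show ?thesis using assms by (simp add: history_def)
qed

lemma id_measurable_past:
  assumes "space N = space M" "\<And>i l. 1 \<le> l \<Longrightarrow> l < t \<Longrightarrow> \<xi> i l \<in> measurable N Q"
  shows "(\<lambda>\<omega>. \<omega>) \<in> measurable N (past t)"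
  unfolding past_def using history_measurable[OF assms(2)] assms(1)
  by (intro measurable_vimage_algebra2) auto

lemma measurable_past_Suc: "f \<in> measurable (past t) N \<Longrightarrow> f \<in> measurable (past (Suc t)) N"
  by (rule measurable_compose[OF id_measurable_past]) (auto intro: \<xi>_measurable_past)

lemma measurable_past_M: "f \<in> measurable (past t) N \<Longrightarrow> f \<in> measurable M N"
  by (rule measurable_compose[OF id_measurable_past]) (auto intro: \<xi>_measurable)

lemma input_eq:
  assumes "\<omega> \<in> space M"
  shows "compressed_run.input s (zh \<omega>) (z \<omega>) j t = (z \<omega> j t - zh \<omega> j (t - 1)) /\<^sub>R s t"
  by (rule compressed_run.input_def[OF pathwise[OF assms]])

lemma comp_err_eq:
  assumes "\<omega> \<in> space M"
  shows "comp_err j t \<omega> = norm (Comp ((z \<omega> j t - zh \<omega> j (t - 1)) /\<^sub>R s t) (\<xi> j t \<omega>)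
    - (z \<omega> j t - zh \<omega> j (t - 1)) /\<^sub>R s t)"
  by (simp add: comp_err_def compressed_run.err_def[OF pathwise[OF assms]] input_eq[OF assms])

lemma closest_point_measurable: "closest_point X \<in> borel_measurable borel"
proof -
  obtain \<omega> where \<omega>: "\<omega> \<in> space M" using not_empty by auto
  interpret compressed_run X m df g dg E W B \<alpha> \<gamma> s z1 "\<lambda>j t u. Comp u (\<xi> j t \<omega>)"
    "zh \<omega>" "z \<omega>" "x \<omega>" "om \<omega>" "v \<omega>" R G1 G2 L w \<gamma>0
    by (rule pathwise[OF \<omega>])
  show ?thesis
    using X X_nonempty by (intro borel_measurable_continuous_onI continuous_on_closest_point)
qed

lemma composition_measurable:
  assumes "continuous_on X h" "y \<in> borel_measurable N" "\<And>\<omega>. \<omega> \<in> space N \<Longrightarrow> y \<omega> \<in> X"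
  shows "(\<lambda>\<omega>. h (y \<omega>)) \<in> borel_measurable N"
proof -
  have "y \<in> measurable N (restrict_space borel X)"
    using assms by (intro measurable_restrict_space2) auto
  then show ?thesis
    by (rule measurable_compose) (rule borel_measurable_continuous_on_restrict[OF assms(1)])
qed

text \<open>Induction along the recursion. At time \<open>t\<close> the variable \<open>z\<close>
  and the previous compressed variable are known before the draw, while the new compressed variable
  and \<open>x\<close> depend on it; the one-step offset in the conclusions makes the compressor
  input a function of the past.\<close>

lemma states_measurable:
  assumes "t \<ge> 1"
  shows "(\<lambda>\<omega>. z \<omega> i t) \<in> borel_measurable (past t)"
    and "(\<lambda>\<omega>. zh \<omega> i (t - 1)) \<in> borel_measurable (past t)"
    and "(\<lambda>\<omega>. x \<omega> i t) \<in> borel_measurable (past (Suc t))"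
proof -
  note step = compressed_run.run_step[OF pathwise]
  note [measurable] = closest_point_measurable
  have zh_Suc: "(\<lambda>\<omega>. zh \<omega> j t) \<in> borel_measurable (past (Suc t))"
    if t: "t \<ge> 1" and [measurable]: "(\<lambda>\<omega>. z \<omega> j t) \<in> borel_measurable (past (Suc t))"
      "(\<lambda>\<omega>. zh \<omega> j (t - 1)) \<in> borel_measurable (past (Suc t))" for t j
  proof -
    have [measurable]: "(\<lambda>\<omega>. Comp ((z \<omega> j t - zh \<omega> j (t - 1)) /\<^sub>R s t) (\<xi> j t \<omega>)) \<in> borel_measurable (past (Suc t))"
    proof -
      have "(\<lambda>\<omega>. ((z \<omega> j t - zh \<omega> j (t - 1)) /\<^sub>R s t, \<xi> j t \<omega>)) \<in> measurable (past (Suc t)) (borel \<Otimes>\<^sub>M Q)"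
        using \<xi>_measurable_past[of t "Suc t" j] t by measurable
      from measurable_compose[OF this Comp_measurable] show ?thesis by simp
    qed
    have "(\<lambda>\<omega>. closest_point X (zh \<omega> j (t - 1)
        + s t *\<^sub>R Comp ((z \<omega> j t - zh \<omega> j (t - 1)) /\<^sub>R s t) (\<xi> j t \<omega>))) \<in> borel_measurable (past (Suc t))"
      by measurable
    then show ?thesis
      \<comment> \<open>The recursion holds only for outcomes in \<open>space M\<close>, which is
        enough to transfer measurability from its right-hand side.\<close>
      by (rule measurable_cong[THEN iffD1, rotated]) (simp add: step(1)[OF _ t] input_eq)
  qed
  have x_meas: "(\<lambda>\<omega>. x \<omega> i t) \<in> borel_measurable (past (Suc t))"
    if t: "t \<ge> 1" and [measurable]: "\<And>j. (\<lambda>\<omega>. zh \<omega> j t) \<in> borel_measurable (past (Suc t))" for t i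
  proof -
    have "(\<lambda>\<omega>. \<Sum>j\<in>UNIV. W t $ i $ j *\<^sub>R zh \<omega> j t) \<in> borel_measurable (past (Suc t))"
      by measurable
    then show ?thesis
      by (rule measurable_cong[THEN iffD1, rotated]) (simp add: step(2)[OF _ t])
  qed
  have z_Suc: "(\<lambda>\<omega>. z \<omega> i (Suc t)) \<in> borel_measurable (past (Suc t))"
    if t: "t \<ge> 1" and [measurable]: "(\<lambda>\<omega>. x \<omega> i t) \<in> borel_measurable (past (Suc t))" for t i
  proof -
    have x_X: "x \<omega> i t \<in> X" if "\<omega> \<in> space M" for \<omega>
      by (rule compressed_run.x_in[OF pathwise[OF that] t])
    \<comment> \<open>Continuity of the data does not depend on the outcome, so the run of any
      single outcome provides it.\<close>
    obtain \<omega>0 where \<omega>0: "\<omega>0 \<in> space M" using not_empty by auto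
    have [measurable]: "(\<lambda>\<omega>. df i t (x \<omega> i t)) \<in> borel_measurable (past (Suc t))"
      by (rule composition_measurable[OF compressed_run.continuous_on_df[OF pathwise[OF \<omega>0] t]])
         (use x_X in auto)
    have [measurable]: "(\<lambda>\<omega>. g i t (x \<omega> i t) k) \<in> borel_measurable (past (Suc t))" if "k < m i" for k
      by (rule composition_measurable[OF compressed_run.continuous_on_g[OF pathwise[OF \<omega>0] t that]])
         (use x_X in auto)
    have [measurable]: "(\<lambda>\<omega>. dg i t (x \<omega> i t) k) \<in> borel_measurable (past (Suc t))" if "k < m i" for k
      by (rule measurable_compose[OF _ g_measurable[OF t that]])
         (use x_X in \<open>auto intro!: measurable_restrict_space2\<close>)
    have "(\<lambda>\<omega>. \<Sum>k<m i. (\<gamma> t * max 0 (g i t (x \<omega> i t) k)) *\<^sub>R dg i t (x \<omega> i t) k)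
        \<in> borel_measurable (past (Suc t))"
      by (intro borel_measurable_sum borel_measurable_scaleR borel_measurable_times
          borel_measurable_max borel_measurable_const) auto
    then have "(\<lambda>\<omega>. closest_point X (x \<omega> i t - \<alpha> t *\<^sub>R (df i t (x \<omega> i t)
        + (\<Sum>k<m i. (\<gamma> t * max 0 (g i t (x \<omega> i t) k)) *\<^sub>R dg i t (x \<omega> i t) k))))
        \<in> borel_measurable (past (Suc t))"
      by measurable
    then show ?thesis
      by (rule measurable_cong[THEN iffD1, rotated]) (simp add: step(3,4)[OF _ t])
  qed
  have "\<forall>i. (\<lambda>\<omega>. z \<omega> i t) \<in> borel_measurable (past t) \<and> (\<lambda>\<omega>. zh \<omega> i (t - 1)) \<in> borel_measurable (past t)"
    using assms
  proof (induction t rule: dec_induct)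
    case base
    have zero: "z \<omega> i 1 = z1 i" "zh \<omega> i 0 = 0" if "\<omega> \<in> space M" for \<omega> i
      using compressed_run.z_1[OF pathwise[OF that]] compressed_run.run[OF pathwise[OF that]]
      by (auto simp: algorithm_run_def)
    have "(\<lambda>\<omega>. z \<omega> i 1) \<in> borel_measurable (past 1)" for i
      by (subst measurable_cong[where g = "\<lambda>_. z1 i"]) (simp_all only: zero space_past borel_measurable_const)
    moreover have "(\<lambda>\<omega>. zh \<omega> i 0) \<in> borel_measurable (past 1)" for i
      by (subst measurable_cong[where g = "\<lambda>_. 0"]) (simp_all only: zero space_past borel_measurable_const)
    ultimately show ?case by simp
  next
    case (step t)
    have t: "t \<ge> 1" using step by simp
    have "(\<lambda>\<omega>. zh \<omega> j t) \<in> borel_measurable (past (Suc t))" for j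
      using step by (intro zh_Suc measurable_past_Suc t) auto
    then show ?case
      using t by (auto intro!: z_Suc x_meas)
  qed
  note * = this[rule_format]
  from * show "(\<lambda>\<omega>. z \<omega> i t) \<in> borel_measurable (past t)"
    "(\<lambda>\<omega>. zh \<omega> i (t - 1)) \<in> borel_measurable (past t)" by auto
  show "(\<lambda>\<omega>. x \<omega> i t) \<in> borel_measurable (past (Suc t))"
    using * by (intro x_meas zh_Suc measurable_past_Suc assms) auto
qed

lemma x_measurable: "t \<ge> 1 \<Longrightarrow> (\<lambda>\<omega>. x \<omega> i t) \<in> borel_measurable M"
  by (rule measurable_past_M[OF states_measurable(3)])

lemma nn_integral_comp_err_square_le:
  assumes t: "t \<ge> 1"
  shows "(\<integral>\<^sup>+ \<omega>. ennreal ((comp_err j t \<omega>)\<^sup>2) \<partial>M) \<le> ennreal C"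
proof -
  let ?U = "\<lambda>\<omega>. (z \<omega> j t - zh \<omega> j (t - 1)) /\<^sub>R s t"
  let ?\<phi> = "\<lambda>(u, r). ennreal ((norm (Comp u r - u))\<^sup>2)"
  have "(\<integral>\<^sup>+ \<omega>. ennreal ((comp_err j t \<omega>)\<^sup>2) \<partial>M) = (\<integral>\<^sup>+ \<omega>. ?\<phi> (?U \<omega>, \<xi> j t \<omega>) \<partial>M)"
    by (intro nn_integral_cong) (simp add: comp_err_eq)
  also have "\<dots> = (\<integral>\<^sup>+ \<omega>. (\<integral>\<^sup>+ r. ?\<phi> (?U \<omega>, r) \<partial>Q) \<partial>M)"
  proof (rule nn_integral_fresh)
    show "history t \<in> measurable M (PiM (UNIV \<times> {1..<t}) (\<lambda>_. Q))"
      by (intro history_measurable \<xi>_measurable)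
    show "\<xi> j t \<in> measurable M Q" by (rule \<xi>_measurable[OF t])
    show "distr M Q (\<xi> j t) = Q" using fresh t by (auto simp: fresh_randomness_def)
    show "indep_set {\<xi> j t -` A \<inter> space M | A. A \<in> sets Q}
        {history t -` A \<inter> space M | A. A \<in> sets (PiM (UNIV \<times> {1..<t}) (\<lambda>_. Q))}"
      using fresh t unfolding fresh_randomness_def history_def by blast
    show "?U \<in> measurable (vimage_algebra (space M) (history t) (PiM (UNIV \<times> {1..<t}) (\<lambda>_. Q))) borel"
      unfolding past_def[symmetric] using states_measurable[OF t, of j] by measurable
    show "?\<phi> \<in> borel_measurable (borel \<Otimes>\<^sub>M Q)"
      using Comp_measurable by (simp add: case_prod_unfold)
  qed (rule Q.prob_space_axioms)
  also have "\<dots> \<le> (\<integral>\<^sup>+ \<omega>. ennreal C \<partial>M)"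
    using C(2) by (intro nn_integral_mono) auto
  finally show ?thesis by (simp add: emeasure_space_1)
qed

lemma comp_err_measurable:
  assumes t: "t \<ge> 1"
  shows "comp_err j t \<in> borel_measurable M"
proof -
  have [measurable]: "(\<lambda>\<omega>. (z \<omega> j t - zh \<omega> j (t - 1)) /\<^sub>R s t) \<in> borel_measurable M"
    using states_measurable(1,2)[OF t, THEN measurable_past_M, of j] by measurable
  have "(\<lambda>\<omega>. ((z \<omega> j t - zh \<omega> j (t - 1)) /\<^sub>R s t, \<xi> j t \<omega>)) \<in> measurable M (borel \<Otimes>\<^sub>M Q)"
    using \<xi>_measurable[OF t, of j] by measurable
  from measurable_compose[OF this Comp_measurable]
  have [measurable]: "(\<lambda>\<omega>. Comp ((z \<omega> j t - zh \<omega> j (t - 1)) /\<^sub>R s t) (\<xi> j t \<omega>)) \<in> borel_measurable M"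
    by simp
  have "(\<lambda>\<omega>. norm (Comp ((z \<omega> j t - zh \<omega> j (t - 1)) /\<^sub>R s t) (\<xi> j t \<omega>)
      - (z \<omega> j t - zh \<omega> j (t - 1)) /\<^sub>R s t)) \<in> borel_measurable M"
    by measurable
  then show ?thesis
    by (rule measurable_cong[THEN iffD1, rotated]) (simp add: comp_err_eq)
qed

lemma comp_err:
  assumes t: "t \<ge> 1"
  shows "integrable M (comp_err j t)" "expectation (comp_err j t) \<le> 1 + C"
proof -
  note [measurable] = comp_err_measurable[OF t, of j]
  have nonneg: "0 \<le> comp_err j t \<omega>" if "\<omega> \<in> space M" for \<omega>
    using that by (simp add: comp_err_eq)
  have "e \<le> 1 + e\<^sup>2" for e :: real
    using sum_squares_bound[of e 1] zero_le_power2[of e]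
    unfolding power_one mult_1_right by linarith
  then have "(\<integral>\<^sup>+ \<omega>. ennreal (comp_err j t \<omega>) \<partial>M) \<le> (\<integral>\<^sup>+ \<omega>. 1 + ennreal ((comp_err j t \<omega>)\<^sup>2) \<partial>M)"
    by (intro nn_integral_mono) (simp add: ennreal_plus[symmetric] ennreal_1[symmetric] ennreal_leI
        del: ennreal_plus ennreal_1)
  also have "\<dots> = 1 + (\<integral>\<^sup>+ \<omega>. ennreal ((comp_err j t \<omega>)\<^sup>2) \<partial>M)"
    by (simp add: nn_integral_add emeasure_space_1)
  also have "\<dots> \<le> 1 + ennreal C"
    by (intro add_left_mono nn_integral_comp_err_square_le t)
  also have "\<dots> = ennreal (1 + C)"
    using C(1) by simp
  finally have le: "(\<integral>\<^sup>+ \<omega>. ennreal (comp_err j t \<omega>) \<partial>M) \<le> ennreal (1 + C)" .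
  show "integrable M (comp_err j t)"
    using nonneg by (intro integrableI_nonneg) (auto intro: le_less_trans[OF le])
  have "expectation (comp_err j t) = enn2real (\<integral>\<^sup>+ \<omega>. ennreal (comp_err j t \<omega>) \<partial>M)"
    using nonneg by (intro integral_eq_nn_integral) auto
  also have "\<dots> \<le> enn2real (ennreal (1 + C))"
    using le by (intro enn2real_mono) auto
  also have "\<dots> = 1 + C"
    by (rule enn2real_ennreal) (use C(1) in simp)
  finally show "expectation (comp_err j t) \<le> 1 + C" .
qed

lemma expectation_le_comp_err:
  assumes Y: "integrable M Y"
    and c: "\<And>t. t \<in> {1..T} \<Longrightarrow> 0 \<le> c t"
    and le: "\<And>\<omega>. \<omega> \<in> space M \<Longrightarrow> Y \<omega> \<le> a + (\<Sum>t=1..T. c t * (\<Sum>j\<in>UNIV. comp_err j t \<omega>))"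
  shows "expectation Y \<le> a + real CARD('n) * (1 + C) * (\<Sum>t=1..T. c t)"
proof -
  have int: "integrable M (\<lambda>\<omega>. c t * (\<Sum>j\<in>UNIV. comp_err j t \<omega>))" if "t \<in> {1..T}" for t
    using comp_err(1) that by (intro integrable_mult_right Bochner_Integration.integrable_sum) auto
  have "expectation (\<lambda>\<omega>. \<Sum>t=1..T. c t * (\<Sum>j\<in>UNIV. comp_err j t \<omega>))
      = (\<Sum>t=1..T. expectation (\<lambda>\<omega>. c t * (\<Sum>j\<in>UNIV. comp_err j t \<omega>)))"
    using int by (rule Bochner_Integration.integral_sum)
  also have "\<dots> = (\<Sum>t=1..T. c t * (\<Sum>j\<in>UNIV. expectation (comp_err j t)))"
    using comp_err(1) by (intro sum.cong) auto
  finally have linear: "expectation (\<lambda>\<omega>. \<Sum>t=1..T. c t * (\<Sum>j\<in>UNIV. comp_err j t \<omega>)) = \<dots>" .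
  have "expectation Y \<le> expectation (\<lambda>\<omega>. a + (\<Sum>t=1..T. c t * (\<Sum>j\<in>UNIV. comp_err j t \<omega>)))"
    using Y le int
    by (intro integral_mono Bochner_Integration.integrable_add Bochner_Integration.integrable_sum) auto
  also have "\<dots> = a + expectation (\<lambda>\<omega>. \<Sum>t=1..T. c t * (\<Sum>j\<in>UNIV. comp_err j t \<omega>))"
    using int by (subst Bochner_Integration.integral_add) (auto simp: prob_space)
  also have "\<dots> = a + (\<Sum>t=1..T. c t * (\<Sum>j\<in>UNIV. expectation (comp_err j t)))"
    by (simp only: linear)
  also have "\<dots> \<le> a + (\<Sum>t=1..T. c t * (\<Sum>j\<in>(UNIV::'n set). 1 + C))"
    using c comp_err(2) by (intro add_left_mono sum_mono mult_left_mono) auto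
  also have "\<dots> = a + real CARD('n) * (1 + C) * (\<Sum>t=1..T. c t)"
    by (simp add: sum_distrib_left mult_ac)
  finally show ?thesis .
qed

section \<open>Integrability and expectation of regret and violation\<close>

lemma g_x_measurable:
  assumes t: "t \<ge> 1" and k: "k < m j"
  shows "(\<lambda>\<omega>. g j t (x \<omega> i t) k) \<in> borel_measurable M"
proof -
  obtain \<omega>0 where \<omega>0: "\<omega>0 \<in> space M" using not_empty by auto
  show ?thesis
    by (rule composition_measurable[OF compressed_run.continuous_on_g[OF pathwise[OF \<omega>0] t k] x_measurable[OF t]])
       (rule compressed_run.x_in[OF pathwise t])
qed

lemma avg_grad_measurable:
  assumes t: "t \<ge> 1"
  shows "(\<lambda>\<omega>. avg_grad df t (x \<omega> i t)) \<in> borel_measurable M"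
proof -
  obtain \<omega>0 where \<omega>0: "\<omega>0 \<in> space M" using not_empty by auto
  have [measurable]: "(\<lambda>\<omega>. df j t (x \<omega> i t)) \<in> borel_measurable M" for j
    by (rule composition_measurable[OF compressed_run.continuous_on_df[OF pathwise[OF \<omega>0] t] x_measurable[OF t]])
       (rule compressed_run.x_in[OF pathwise t])
  show ?thesis unfolding avg_grad_def by measurable
qed

lemma net_ccv_measurable: "(\<lambda>\<omega>. net_ccv m g (x \<omega>) T) \<in> borel_measurable M"
proof -
  have "(\<lambda>\<omega>. (max 0 (g j t (x \<omega> i t) k))\<^sup>2) \<in> borel_measurable M" if "t \<in> {1..T}" "k < m j" for i j k t
    using that by (intro borel_measurable_power borel_measurable_max borel_measurable_const g_x_measurable) auto
  then have "(\<lambda>\<omega>. L2_set (\<lambda>(j, k). max 0 (g j t (x \<omega> i t) k)) (SIGMA j:UNIV. {..<m j})) \<in> borel_measurable M"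
    if "t \<in> {1..T}" for i t
    using that unfolding L2_set_def case_prod_unfold
    by (intro borel_measurable_sqrt[THEN measurable_compose[rotated]] borel_measurable_sum) auto
  then show ?thesis
    unfolding net_ccv_def by (intro borel_measurable_times borel_measurable_const borel_measurable_sum)
qed

lemma integrable_net_reg:
  assumes T: "T \<ge> 1"
  shows "integrable M (\<lambda>\<omega>. net_reg X m df g (x \<omega>) T)"
proof -
  obtain \<omega>0 where \<omega>0: "\<omega>0 \<in> space M" using not_empty by auto
  note at = compressed_run.X(3)[OF pathwise[OF \<omega>0]] compressed_run.f_bound[OF pathwise[OF \<omega>0]]
    compressed_run.R_nonneg[OF pathwise[OF \<omega>0]] compressed_run.G_nonneg[OF pathwise[OF \<omega>0]]
  let ?h = "\<lambda>q. INF y\<in>feasible_set X m g T. q \<bullet> y"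
  have FX: "norm y \<le> R" if "y \<in> feasible_set X m g T" for y
    using that at(1) by (auto simp: feasible_set_def)
  note h = continuous_on_cINF_inner[OF feasible[OF T] FX]
  have [measurable]: "(\<lambda>\<omega>. x \<omega> i t) \<in> borel_measurable M"
    "(\<lambda>\<omega>. avg_grad df t (x \<omega> i t)) \<in> borel_measurable M" if "t \<in> {1..T}" for i t
    using that by (auto intro: x_measurable avg_grad_measurable)
  have [measurable]: "?h \<in> borel_measurable borel"
    by (intro borel_measurable_continuous_onI h(1))
  have meas: "(\<lambda>\<omega>. net_reg X m df g (x \<omega>) T) \<in> borel_measurable M"
    unfolding net_reg_def
  proof (intro borel_measurable_times borel_measurable_const borel_measurable_sum borel_measurable_diff
      borel_measurable_inner measurable_compose[OF _ \<open>?h \<in> borel_measurable borel\<close>])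
  qed (auto intro: x_measurable avg_grad_measurable)
  \<comment> \<open>For fixed \<open>T\<close> the regret is bounded on all outcomes: decisions and
    comparators have norm at most \<open>R\<close>, gradients at most \<open>G1\<close>. With
    measurability this gives integrability.\<close>
  have "\<bar>net_reg X m df g (x \<omega>) T\<bar> \<le> 2 * real T * (G1 * R)" if \<omega>: "\<omega> \<in> space M" for \<omega>
  proof -
    have x_X: "t \<ge> 1 \<Longrightarrow> x \<omega> i t \<in> X" for i t by (rule compressed_run.x_in[OF pathwise[OF \<omega>]])
    have grad: "norm (avg_grad df t (x \<omega> i t)) \<le> G1" if "t \<in> {1..T}" for i t
    proof -
      have "norm (\<Sum>j\<in>UNIV. df j t (x \<omega> i t)) \<le> (\<Sum>j\<in>(UNIV::'n set). G1)"
        using that by (intro sum_norm_le at(2) x_X) auto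
      then show ?thesis by (simp add: avg_grad_def field_simps)
    qed
    have "\<bar>(\<Sum>t=1..T. avg_grad df t (x \<omega> i t) \<bullet> x \<omega> i t)
        - ?h (\<Sum>t=1..T. avg_grad df t (x \<omega> i t))\<bar> \<le> 2 * real T * (G1 * R)" for i
    proof -
      have "norm (\<Sum>t=1..T. avg_grad df t (x \<omega> i t) \<bullet> x \<omega> i t) \<le> (\<Sum>t=1..T. G1 * R)"
        using grad x_X at
        by (intro sum_norm_le) (auto intro!: order_trans[OF Cauchy_Schwarz_ineq2] mult_mono)
      moreover have "norm (\<Sum>t=1..T. avg_grad df t (x \<omega> i t)) \<le> (\<Sum>t=1..T. G1)"
        using grad by (intro sum_norm_le)
      then have "R * norm (\<Sum>t=1..T. avg_grad df t (x \<omega> i t)) \<le> R * (\<Sum>t=1..T. G1)"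
        using at by (intro mult_left_mono)
      ultimately show ?thesis
        using h(2)[of "\<Sum>t=1..T. avg_grad df t (x \<omega> i t)"] by (simp add: algebra_simps)
    qed
    then have "\<bar>\<Sum>i\<in>UNIV. (\<Sum>t=1..T. avg_grad df t (x \<omega> i t) \<bullet> x \<omega> i t)
        - ?h (\<Sum>t=1..T. avg_grad df t (x \<omega> i t))\<bar> \<le> (\<Sum>i\<in>(UNIV::'n set). 2 * real T * (G1 * R))"
      by (intro sum_abs[THEN order_trans] sum_mono)
    then show ?thesis
      by (simp add: net_reg_def abs_mult field_simps)
  qed
  then show ?thesis
    using meas by (intro integrable_const_bound[where B = "2 * real T * (G1 * R)"]) auto
qed

lemma expectation_net_reg_le:
  assumes T: "T \<ge> 1"
  defines "A \<equiv> (2 * R * \<bar>L\<bar> + G1) * mixing_const CARD('n) B w"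
  shows "expectation (\<lambda>\<omega>. net_reg X m df g (x \<omega>) T) \<le> 2 * R\<^sup>2 / \<alpha> T + A * R
    + (G1\<^sup>2 + (real CARD('n) * A * G2)\<^sup>2 * \<gamma>0 / 3 + A * real CARD('n) * G1) * (\<Sum>t=1..T. \<alpha> t)
    + real CARD('n) * (1 + C) * (\<Sum>t=1..T. (2 * R / (real CARD('n) * \<alpha> t) + A) * s t)"
proof (rule expectation_le_comp_err)
  show "integrable M (\<lambda>\<omega>. net_reg X m df g (x \<omega>) T)"
    by (rule integrable_net_reg[OF T])
next
  fix t assume "t \<in> {1..T}"
  obtain \<omega>0 where "\<omega>0 \<in> space M" using not_empty by auto
  then interpret compressed_run X m df g dg E W B \<alpha> \<gamma> s z1 "\<lambda>j t u. Comp u (\<xi> j t \<omega>0)"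
    "zh \<omega>0" "z \<omega>0" "x \<omega>0" "om \<omega>0" "v \<omega>0" R G1 G2 L w \<gamma>0
    by (rule pathwise)
  show "0 \<le> (2 * R / (real CARD('n) * \<alpha> t) + A) * s t"
    using \<open>t \<in> {1..T}\<close> \<alpha>(1)[of t] s[of t] R_nonneg G_nonneg mixing_const_nonneg
    by (auto simp: A_def intro!: mult_nonneg_nonneg add_nonneg_nonneg)
next
  fix \<omega> assume \<omega>: "\<omega> \<in> space M"
  show "net_reg X m df g (x \<omega>) T \<le> 2 * R\<^sup>2 / \<alpha> T + A * R
    + (G1\<^sup>2 + (real CARD('n) * A * G2)\<^sup>2 * \<gamma>0 / 3 + A * real CARD('n) * G1) * (\<Sum>t=1..T. \<alpha> t)
    + (\<Sum>t=1..T. (2 * R / (real CARD('n) * \<alpha> t) + A) * s t * (\<Sum>j\<in>UNIV. comp_err j t \<omega>))"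
    using compressed_run.net_reg_le[OF pathwise[OF \<omega>] feasible[OF T] T]
    by (simp add: A_def comp_err_def mult.assoc)
qed

text \<open>The agents' own violations enter twice, directly and through the disagreement, hence the
  factor \<open>1 + q * G2 * \<gamma>0\<close>. The parameters \<open>a\<close> and \<open>c\<close>
  let the general and the Slater case share the computation.\<close>

lemma expectation_net_ccv_le:
  assumes c: "c \<ge> 0"
    and viol: "\<And>\<omega>. \<omega> \<in> space M \<Longrightarrow> (\<Sum>t=1..T. \<Sum>i\<in>UNIV. compressed_run.viol m g (x \<omega>) i t)
      \<le> a + c * (\<Sum>t=1..T. s t * (\<Sum>j\<in>UNIV. comp_err j t \<omega>))"
  defines "q \<equiv> real CARD('n) * G2 * mixing_const CARD('n) B w"
  shows "integrable M (\<lambda>\<omega>. net_ccv m g (x \<omega>) T)" (is ?int)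
    and "expectation (\<lambda>\<omega>. net_ccv m g (x \<omega>) T)
      \<le> (1 + q * G2 * \<gamma>0) * a + q * (R + real CARD('n) * G1 * (\<Sum>t=1..T. \<alpha> t))
        + real CARD('n) * (1 + C) * ((1 + q * G2 * \<gamma>0) * c + q) * (\<Sum>t=1..T. s t)" (is ?exp)
proof -
  obtain \<omega>0 where "\<omega>0 \<in> space M" using not_empty by auto
  then interpret r0: compressed_run X m df g dg E W B \<alpha> \<gamma> s z1 "\<lambda>j t u. Comp u (\<xi> j t \<omega>0)"
    "zh \<omega>0" "z \<omega>0" "x \<omega>0" "om \<omega>0" "v \<omega>0" R G1 G2 L w \<gamma>0
    by (rule pathwise)
  define P where "P = 1 + q * G2 * \<gamma>0"
  define a' where "a' = P * a + q * (R + real CARD('n) * G1 * (\<Sum>t=1..T. \<alpha> t))"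
  have q: "q \<ge> 0" "P \<ge> 0"
    using r0.G_nonneg r0.mixing_const_nonneg r0.\<gamma>0 by (auto simp: q_def P_def)
  have le: "net_ccv m g (x \<omega>) T \<le> a' + (\<Sum>t=1..T. ((P * c + q) * s t) * (\<Sum>j\<in>UNIV. comp_err j t \<omega>))"
    if \<omega>: "\<omega> \<in> space M" for \<omega>
  proof -
    interpret compressed_run X m df g dg E W B \<alpha> \<gamma> s z1 "\<lambda>j t u. Comp u (\<xi> j t \<omega>)"
      "zh \<omega>" "z \<omega>" "x \<omega>" "om \<omega>" "v \<omega>" R G1 G2 L w \<gamma>0
      by (rule pathwise[OF \<omega>])
    let ?V = "\<Sum>t=1..T. \<Sum>i\<in>UNIV. viol i t" and ?S = "\<Sum>t=1..T. s t * (\<Sum>j\<in>UNIV. err j t)"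
    have "net_ccv m g (x \<omega>) T \<le> ?V + real CARD('n) * G2 * (\<Sum>t=1..T. diam (\<lambda>i. x \<omega> i t))"
      by (rule net_ccv_le)
    also have "\<dots> \<le> ?V + real CARD('n) * G2 * (mixing_const CARD('n) B w * (R + ?S
        + real CARD('n) * G1 * (\<Sum>t=1..T. \<alpha> t) + G2 * \<gamma>0 * ?V))"
      using G_nonneg by (intro add_left_mono mult_left_mono sum_diam_x_le) auto
    also have "\<dots> = P * ?V + q * (R + real CARD('n) * G1 * (\<Sum>t=1..T. \<alpha> t)) + q * ?S"
      by (simp add: P_def q_def algebra_simps)
    also have "\<dots> \<le> P * (a + c * ?S) + q * (R + real CARD('n) * G1 * (\<Sum>t=1..T. \<alpha> t)) + q * ?S"
      using viol[OF \<omega>] q by (intro add_right_mono mult_left_mono) (auto simp: comp_err_def)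
    also have "\<dots> = a' + (P * c + q) * ?S"
      by (simp add: a'_def algebra_simps)
    finally show ?thesis
      by (simp add: sum_distrib_left comp_err_def mult.assoc)
  qed
  have int: "integrable M (\<lambda>\<omega>. a' + (\<Sum>t=1..T. ((P * c + q) * s t) * (\<Sum>j\<in>UNIV. comp_err j t \<omega>)))"
    using comp_err(1)
    by (intro Bochner_Integration.integrable_add Bochner_Integration.integrable_sum integrable_mult_right) auto
  have nonneg: "0 \<le> net_ccv m g y T" for y
    by (simp add: net_ccv_def sum_nonneg)
  show ?int
    using le nonneg
    by (intro Bochner_Integration.integrable_bound[OF int net_ccv_measurable] AE_I2)
      (auto intro: order_trans[OF _ abs_ge_self])
  have "expectation (\<lambda>\<omega>. net_ccv m g (x \<omega>) T)
      \<le> a' + real CARD('n) * (1 + C) * (\<Sum>t=1..T. (P * c + q) * s t)"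
    using \<open>?int\<close> le q c r0.s by (intro expectation_le_comp_err) (auto simp: less_imp_le)
  then show ?exp
    by (simp add: a'_def P_def sum_distrib_left mult.assoc)
qed

end

section \<open>Rates\<close>

locale power_schedule = random_run where m = m for m :: "'n::finite \<Rightarrow> nat" +
  fixes \<alpha>0 s0 \<theta>1 \<theta>2 :: real
  assumes \<theta>: "0 < \<theta>1" "\<theta>1 < 1" "\<theta>1 < \<theta>2"
    and \<alpha>0: "0 < \<alpha>0" and s0: "0 < s0"
    and \<alpha>_eq: "\<And>t. t \<ge> 1 \<Longrightarrow> \<alpha> t = \<alpha>0 / real t powr \<theta>1"
    and s_eq: "\<And>t. t \<ge> 1 \<Longrightarrow> s t = s0 / real t powr \<theta>2"
begin

text \<open>Facts about the parameters alone are read off from the run of an arbitrary outcome.\<close>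

sublocale ex_run: compressed_run X m df g dg E W B \<alpha> \<gamma> s z1
  "\<lambda>j t u. Comp u (\<xi> j t (SOME \<omega>. \<omega> \<in> space M))" "zh (SOME \<omega>. \<omega> \<in> space M)" "z (SOME \<omega>. \<omega> \<in> space M)"
  "x (SOME \<omega>. \<omega> \<in> space M)" "om (SOME \<omega>. \<omega> \<in> space M)" "v (SOME \<omega>. \<omega> \<in> space M)" R G1 G2 L w \<gamma>0
  by (rule pathwise) (simp add: not_empty some_in_eq)

lemma sum_\<alpha>_le: "(\<Sum>t=1..T. \<alpha> t) \<le> \<alpha>0 / (1 - \<theta>1) * real T powr (1 - \<theta>1)"
proof -
  have "(\<Sum>t=1..T. \<alpha> t) = \<alpha>0 * (\<Sum>t=1..T. real t powr (- \<theta>1))"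
    by (auto simp: \<alpha>_eq sum_distrib_left powr_minus divide_simps intro!: sum.cong)
  also have "\<dots> \<le> \<alpha>0 * (real T powr (1 - \<theta>1) / (1 - \<theta>1))"
    using \<theta> \<alpha>0 by (intro mult_left_mono sum_powr_le) auto
  finally show ?thesis by simp
qed

lemma s_le:
  assumes "t \<ge> 1" "b \<le> \<theta>2"
  shows "s t \<le> s0 * real t powr (- b)"
proof -
  have "real t powr (- \<theta>2) \<le> real t powr (- b)"
    using assms by (intro powr_mono) auto
  then show ?thesis
    using s0 assms by (simp add: s_eq powr_minus divide_inverse mult_left_mono)
qed

text \<open>Since \<open>\<theta>2\<close> exceeds \<open>\<theta>1\<close>, the exponent may be
  weakened to \<open>\<theta>1\<close>, which lies below 1; so \<open>\<theta>2 \<ge> 1\<close>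
  needs no separate treatment.\<close>

lemma sum_s_le: "(\<Sum>t=1..T. s t) \<le> s0 / (1 - \<theta>1) * real T powr (1 - \<theta>1)"
proof -
  have "(\<Sum>t=1..T. s t) \<le> (\<Sum>t=1..T. s0 * real t powr (- \<theta>1))"
    using \<theta> by (intro sum_mono s_le) auto
  also have "\<dots> \<le> s0 * (real T powr (1 - \<theta>1) / (1 - \<theta>1))"
    unfolding sum_distrib_left[symmetric] using \<theta> s0 by (intro mult_left_mono sum_powr_le) auto
  finally show ?thesis by simp
qed

lemma one_le_rate: "T \<ge> 1 \<Longrightarrow> 1 \<le> real T powr (1 - \<theta>1)"
  using \<theta> by (intro ge_one_powr_ge_zero) auto

text \<open>The ratio \<open>s t / \<alpha> t\<close> has order t^(\<theta>1 - \<theta>2). Capping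
  \<open>\<theta>2\<close> at 1 gives a decay exponent \<open>\<beta>\<close> strictly between 0 and
  1, so one power sum covers both regimes; the cap costs nothing in the rate, since
  \<open>1 / \<alpha> T\<close> already has order T^\<theta>1, at most T^(1 - \<beta>).\<close>

lemma net_reg_bigo:
  defines "\<beta> \<equiv> min \<theta>2 1 - \<theta>1"
  shows "expectation_bigo M (\<lambda>T \<omega>. net_reg X m df g (x \<omega>) T) (\<lambda>T. real T powr max (1 - \<theta>1) (1 - \<beta>))"
proof -
  define A where "A = (2 * R * \<bar>L\<bar> + G1) * mixing_const CARD('n) B w"
  define D where "D = G1\<^sup>2 + (real CARD('n) * A * G2)\<^sup>2 * \<gamma>0 / 3 + A * real CARD('n) * G1"
  define F where "F = (2 * R / (real CARD('n) * \<alpha>0) + A) * s0"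
  define K where "K = 2 * R\<^sup>2 / \<alpha>0 + A * R + D * (\<alpha>0 / (1 - \<theta>1))
    + real CARD('n) * (1 + C) * (F / (1 - \<beta>))"
  have \<beta>: "0 < \<beta>" "\<beta> < 1" "\<theta>1 \<le> 1 - \<beta>" using \<theta> by (auto simp: \<beta>_def)
  have A: "0 \<le> A"
    using ex_run.R_nonneg ex_run.G_nonneg ex_run.mixing_const_nonneg by (auto simp: A_def)
  then have D: "0 \<le> D" using ex_run.G_nonneg ex_run.\<gamma>0 by (auto simp: D_def)
  have F: "0 \<le> F" using A s0 \<alpha>0 ex_run.R_nonneg by (auto simp: F_def)
  have coeff: "(2 * R / (real CARD('n) * \<alpha> t) + A) * s t \<le> F * real t powr (- \<beta>)" if t: "t \<ge> 1" for t
  proof -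
    have "s t / \<alpha> t = s0 / \<alpha>0 * real t powr (\<theta>1 - \<theta>2)"
      using t s0 \<alpha>0 by (simp add: s_eq \<alpha>_eq powr_diff)
    also have "\<dots> \<le> s0 / \<alpha>0 * real t powr (- \<beta>)"
      using t s0 \<alpha>0 by (intro mult_left_mono powr_mono) (auto simp: \<beta>_def)
    finally have "2 * R / real CARD('n) * (s t / \<alpha> t) \<le> 2 * R / real CARD('n) * (s0 / \<alpha>0 * real t powr (- \<beta>))"
      using ex_run.R_nonneg by (intro mult_left_mono) auto
    moreover have "A * s t \<le> A * (s0 * real t powr (- \<beta>))"
      using t \<theta> A by (intro mult_left_mono s_le) (auto simp: \<beta>_def)
    ultimately show ?thesis by (simp add: F_def algebra_simps)
  qed
  have "integrable M (\<lambda>\<omega>. net_reg X m df g (x \<omega>) T) \<and>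
      expectation (\<lambda>\<omega>. net_reg X m df g (x \<omega>) T) \<le> K * real T powr max (1 - \<theta>1) (1 - \<beta>)" if T: "T \<ge> 1" for T
  proof
    let ?h = "real T powr max (1 - \<theta>1) (1 - \<beta>)"
    have h: "real T powr a \<le> ?h" if "a \<le> max (1 - \<theta>1) (1 - \<beta>)" for a
      using T that by (intro powr_mono) auto
    have "1 / \<alpha> T \<le> ?h / \<alpha>0"
      using T \<alpha>0 h[of \<theta>1] \<beta> by (simp add: \<alpha>_eq divide_right_mono)
    then have 1: "2 * R\<^sup>2 / \<alpha> T \<le> 2 * R\<^sup>2 / \<alpha>0 * ?h"
      using mult_left_mono[of "1 / \<alpha> T" "?h / \<alpha>0" "2 * R\<^sup>2"] by simp
    have 2: "A * R * 1 \<le> A * R * ?h"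
      using h[of 0] T A ex_run.R_nonneg \<theta> by (intro mult_left_mono) auto
    have "(\<Sum>t=1..T. \<alpha> t) \<le> \<alpha>0 / (1 - \<theta>1) * ?h"
      using \<theta> \<alpha>0 by (intro order_trans[OF sum_\<alpha>_le] mult_left_mono h) auto
    then have 3: "D * (\<Sum>t=1..T. \<alpha> t) \<le> D * (\<alpha>0 / (1 - \<theta>1)) * ?h"
      unfolding mult.assoc by (rule mult_left_mono[OF _ D])
    have "(\<Sum>t=1..T. (2 * R / (real CARD('n) * \<alpha> t) + A) * s t) \<le> (\<Sum>t=1..T. F * real t powr (- \<beta>))"
      by (intro sum_mono coeff) auto
    also have "\<dots> \<le> F * (real T powr (1 - \<beta>) / (1 - \<beta>))"
      unfolding sum_distrib_left[symmetric] using \<beta> F by (intro mult_left_mono sum_powr_le) auto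
    also have "\<dots> \<le> F * (?h / (1 - \<beta>))"
      using \<beta> F by (intro mult_left_mono divide_right_mono h) auto
    finally have 4: "real CARD('n) * (1 + C) * (\<Sum>t=1..T. (2 * R / (real CARD('n) * \<alpha> t) + A) * s t)
        \<le> real CARD('n) * (1 + C) * (F / (1 - \<beta>)) * ?h"
      using mult_left_mono[of _ "F * (?h / (1 - \<beta>))" "real CARD('n) * (1 + C)"] C(1)
      by (simp add: mult.assoc)
    show "expectation (\<lambda>\<omega>. net_reg X m df g (x \<omega>) T) \<le> K * ?h"
      using expectation_net_reg_le[OF T, folded A_def, folded D_def] 1 2 3 4
      unfolding K_def distrib_right by linarith
  qed (rule integrable_net_reg[OF T])
  then show ?thesis unfolding expectation_bigo_def by blast
qed

text \<open>
  The factor \<open>\<tau>\<close> is the weight in Young's inequality $b \le \tau b^2 / 2 + 1 / (2 \tau)$: it is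
  $T^{\theta_1/2}$ in general and 1 under Slater's condition.
\<close>

lemma net_ccv_bigo_aux:
  assumes "\<exists>k\<ge>0. \<exists>c\<ge>0. \<forall>T\<ge>1. \<exists>\<tau>\<ge>1. \<tau> * real T powr (1 - \<theta>1) \<le> h T \<and> (\<forall>\<omega>\<in>space M.
      (\<Sum>t=1..T. \<Sum>i\<in>UNIV. compressed_run.viol m g (x \<omega>) i t)
        \<le> k * h T + c * \<tau> * (\<Sum>t=1..T. s t * (\<Sum>j\<in>UNIV. comp_err j t \<omega>)))"
  shows "expectation_bigo M (\<lambda>T \<omega>. net_ccv m g (x \<omega>) T) h"
proof -
  obtain k c where kc: "k \<ge> 0" "c \<ge> 0" and
    ex: "\<And>T. T \<ge> 1 \<Longrightarrow> \<exists>\<tau>\<ge>1. \<tau> * real T powr (1 - \<theta>1) \<le> h T \<and> (\<forall>\<omega>\<in>space M.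
      (\<Sum>t=1..T. \<Sum>i\<in>UNIV. compressed_run.viol m g (x \<omega>) i t)
        \<le> k * h T + c * \<tau> * (\<Sum>t=1..T. s t * (\<Sum>j\<in>UNIV. comp_err j t \<omega>)))"
    using assms by blast
  define q where "q = real CARD('n) * G2 * mixing_const CARD('n) B w"
  define P where "P = 1 + q * G2 * \<gamma>0"
  define K where "K = P * k + q * (R + real CARD('n) * G1 * (\<alpha>0 / (1 - \<theta>1)))
    + real CARD('n) * (1 + C) * (P * c + q) * (s0 / (1 - \<theta>1))"
  have q: "q \<ge> 0" "P \<ge> 0"
    using ex_run.G_nonneg ex_run.mixing_const_nonneg ex_run.\<gamma>0 by (auto simp: q_def P_def)
  have "integrable M (\<lambda>\<omega>. net_ccv m g (x \<omega>) T) \<and> expectation (\<lambda>\<omega>. net_ccv m g (x \<omega>) T) \<le> K * h T"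
    if T: "T \<ge> 1" for T
  proof -
    obtain \<tau> where \<tau>: "\<tau> \<ge> 1" "\<tau> * real T powr (1 - \<theta>1) \<le> h T"
      and viol: "\<And>\<omega>. \<omega> \<in> space M \<Longrightarrow> (\<Sum>t=1..T. \<Sum>i\<in>UNIV. compressed_run.viol m g (x \<omega>) i t)
        \<le> k * h T + c * \<tau> * (\<Sum>t=1..T. s t * (\<Sum>j\<in>UNIV. comp_err j t \<omega>))"
      using ex[OF T] by blast
    let ?p = "real T powr (1 - \<theta>1)"
    have "c * \<tau> \<ge> 0" using kc \<tau> by simp
    note le = expectation_net_ccv_le[OF this viol, folded q_def, folded P_def]
    have bound: "integrable M (\<lambda>\<omega>. net_ccv m g (x \<omega>) T)"
      "expectation (\<lambda>\<omega>. net_ccv m g (x \<omega>) T)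
        \<le> P * (k * h T) + q * (R + real CARD('n) * G1 * (\<Sum>t=1..T. \<alpha> t))
          + real CARD('n) * (1 + C) * (P * (c * \<tau>) + q) * (\<Sum>t=1..T. s t)"
      by (rule le(1), assumption, rule le(2))
    have "1 * ?p \<le> \<tau> * ?p" using \<tau> by (intro mult_right_mono) auto
    then have p: "?p \<le> h T" "1 \<le> h T" using \<tau> one_le_rate[OF T] by auto
    have "R * 1 \<le> R * h T" using p ex_run.R_nonneg by (intro mult_left_mono)
    moreover have "(\<Sum>t=1..T. \<alpha> t) \<le> \<alpha>0 / (1 - \<theta>1) * h T"
      using \<theta> \<alpha>0 p by (intro order_trans[OF sum_\<alpha>_le] mult_left_mono) auto
    then have "real CARD('n) * G1 * (\<Sum>t=1..T. \<alpha> t) \<le> real CARD('n) * G1 * (\<alpha>0 / (1 - \<theta>1) * h T)"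
      using ex_run.G_nonneg by (intro mult_left_mono) auto
    ultimately have "q * (R + real CARD('n) * G1 * (\<Sum>t=1..T. \<alpha> t))
        \<le> q * (R * h T + real CARD('n) * G1 * (\<alpha>0 / (1 - \<theta>1) * h T))"
      using q by (intro mult_left_mono) auto
    moreover have "(P * (c * \<tau>) + q) * (\<Sum>t=1..T. s t) \<le> (P * c + q) * (s0 / (1 - \<theta>1)) * h T"
    proof -
      have "(P * (c * \<tau>) + q) * (\<Sum>t=1..T. s t) \<le> ((P * c + q) * \<tau>) * (s0 / (1 - \<theta>1) * ?p)"
      proof (rule mult_mono)
        \<comment> \<open>The term \<open>q\<close> from the disagreement carries no
          \<open>\<tau>\<close>; it may be multiplied by it because
          \<open>\<tau> \<ge> 1\<close>.\<close>
        show "P * (c * \<tau>) + q \<le> (P * c + q) * \<tau>"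
          using mult_left_mono[OF \<tau>(1) q(1)] by (simp add: algebra_simps)
        show "0 \<le> (P * c + q) * \<tau>" using q kc \<tau> by simp
        show "0 \<le> (\<Sum>t=1..T. s t)" using ex_run.s by (intro sum_nonneg less_imp_le) auto
      qed (rule sum_s_le)
      also have "\<dots> = ((P * c + q) * (s0 / (1 - \<theta>1))) * (\<tau> * ?p)" by (simp only: mult_ac)
      also have "\<dots> \<le> ((P * c + q) * (s0 / (1 - \<theta>1))) * h T"
        using \<tau> q kc \<theta> s0 by (intro mult_left_mono) auto
      finally show ?thesis .
    qed
    then have "real CARD('n) * (1 + C) * ((P * (c * \<tau>) + q) * (\<Sum>t=1..T. s t))
        \<le> real CARD('n) * (1 + C) * ((P * c + q) * (s0 / (1 - \<theta>1)) * h T)"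
      using C(1) by (intro mult_left_mono) auto
    moreover have "K * h T = P * (k * h T)
        + q * (R * h T + real CARD('n) * G1 * (\<alpha>0 / (1 - \<theta>1) * h T))
        + real CARD('n) * (1 + C) * ((P * c + q) * (s0 / (1 - \<theta>1)) * h T)"
      by (simp only: K_def distrib_right distrib_left mult.assoc)
    ultimately have "expectation (\<lambda>\<omega>. net_ccv m g (x \<omega>) T) \<le> K * h T"
      using bound(2) by (simp only: mult.assoc)
    then show ?thesis using bound(1) by blast
  qed
  then show ?thesis unfolding expectation_bigo_def by blast
qed

lemma energy_bound_le:
  assumes T: "T \<ge> 1" and \<omega>: "\<omega> \<in> space M"
  shows "4 * real CARD('n) * R\<^sup>2 + 4 * R * (\<Sum>t=1..T. s t * (\<Sum>j\<in>UNIV. comp_err j t \<omega>))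
      + (2 * real CARD('n) * G1\<^sup>2 * \<alpha> 1 + 4 * real CARD('n) * R * G1) * (\<Sum>t=1..T. \<alpha> t)
    \<le> (4 * real CARD('n) * R\<^sup>2 + (2 * real CARD('n) * G1\<^sup>2 * \<alpha> 1 + 4 * real CARD('n) * R * G1) * (\<alpha>0 / (1 - \<theta>1)))
        * real T powr (1 - \<theta>1) + 4 * R * (\<Sum>t=1..T. s t * (\<Sum>j\<in>UNIV. comp_err j t \<omega>))"
proof -
  have "4 * real CARD('n) * R\<^sup>2 * 1 \<le> 4 * real CARD('n) * R\<^sup>2 * real T powr (1 - \<theta>1)"
    using one_le_rate[OF T] by (intro mult_left_mono) auto
  moreover have "(2 * real CARD('n) * G1\<^sup>2 * \<alpha> 1 + 4 * real CARD('n) * R * G1) * (\<Sum>t=1..T. \<alpha> t)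
      \<le> (2 * real CARD('n) * G1\<^sup>2 * \<alpha> 1 + 4 * real CARD('n) * R * G1) * (\<alpha>0 / (1 - \<theta>1) * real T powr (1 - \<theta>1))"
    using ex_run.\<alpha>(1)[of 1] ex_run.G_nonneg ex_run.R_nonneg by (intro mult_left_mono sum_\<alpha>_le) auto
  ultimately show ?thesis
    by (simp only: distrib_right mult.assoc)
qed

lemma net_ccv_bigo:
  "expectation_bigo M (\<lambda>T \<omega>. net_ccv m g (x \<omega>) T) (\<lambda>T. real T powr (1 - \<theta>1 / 2))"
proof (rule net_ccv_bigo_aux)
  define k0 where "k0 = 4 * real CARD('n) * R\<^sup>2
    + (2 * real CARD('n) * G1\<^sup>2 * \<alpha> 1 + 4 * real CARD('n) * R * G1) * (\<alpha>0 / (1 - \<theta>1))"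
  have k0: "k0 \<ge> 0"
    using ex_run.\<alpha>(1)[of 1] ex_run.G_nonneg ex_run.R_nonneg \<alpha>0 \<theta> by (auto simp: k0_def)
  have "\<exists>\<tau>\<ge>1. \<tau> * real T powr (1 - \<theta>1) \<le> real T powr (1 - \<theta>1 / 2) \<and> (\<forall>\<omega>\<in>space M.
      (\<Sum>t=1..T. \<Sum>i\<in>UNIV. compressed_run.viol m g (x \<omega>) i t)
        \<le> (k0 / (3 * \<gamma>0) + real CARD('n) / 2) * real T powr (1 - \<theta>1 / 2)
          + 4 * R / (3 * \<gamma>0) * \<tau> * (\<Sum>t=1..T. s t * (\<Sum>j\<in>UNIV. comp_err j t \<omega>)))" if T: "T \<ge> 1" for T
  \<comment> \<open>This weight balances the two sides of Young's inequality: both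
    \<open>\<tau>\<close> times T^(1 - \<theta>1) and \<open>T / \<tau>\<close> equal T^(1 -
    \<theta>1 / 2).\<close>
  proof (intro exI[of _ "real T powr (\<theta>1 / 2)"] conjI ballI)
    let ?\<tau> = "real T powr (\<theta>1 / 2)" and ?h = "real T powr (1 - \<theta>1 / 2)"
    show \<tau>1: "1 \<le> ?\<tau>" using T \<theta> by (intro ge_one_powr_ge_zero) auto
    have \<tau>p: "?\<tau> * real T powr (1 - \<theta>1) = ?h"
      by (simp flip: powr_add)
    then show "?\<tau> * real T powr (1 - \<theta>1) \<le> ?h" by simp
    have T\<tau>: "real T / ?\<tau> = ?h" using T by (simp add: powr_diff)
    fix \<omega> assume \<omega>: "\<omega> \<in> space M"
    interpret run_\<omega>: compressed_run X m df g dg E W B \<alpha> \<gamma> s z1 "\<lambda>j t u. Comp u (\<xi> j t \<omega>)"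
      "zh \<omega>" "z \<omega>" "x \<omega>" "om \<omega>" "v \<omega>" R G1 G2 L w \<gamma>0
      by (rule pathwise[OF \<omega>])
    let ?S = "\<Sum>t=1..T. s t * (\<Sum>j\<in>UNIV. comp_err j t \<omega>)"
    have "(\<Sum>t=1..T. \<Sum>i\<in>UNIV. run_\<omega>.viol i t) \<le> ?\<tau> / (3 * \<gamma>0) *
        (4 * real CARD('n) * R\<^sup>2 + 4 * R * ?S
          + (2 * real CARD('n) * G1\<^sup>2 * \<alpha> 1 + 4 * real CARD('n) * R * G1) * (\<Sum>t=1..T. \<alpha> t))
        + real CARD('n) * real T / (2 * ?\<tau>)"
      unfolding comp_err_def using T by (intro run_\<omega>.sum_viol_le feasible) auto
    also have "\<dots> \<le> ?\<tau> / (3 * \<gamma>0) * (k0 * real T powr (1 - \<theta>1) + 4 * R * ?S)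
        + real CARD('n) * real T / (2 * ?\<tau>)"
      unfolding k0_def using energy_bound_le[OF T \<omega>] ex_run.\<gamma>0
      by (intro add_right_mono mult_left_mono) auto
    also have "\<dots> = k0 / (3 * \<gamma>0) * (?\<tau> * real T powr (1 - \<theta>1)) + 4 * R / (3 * \<gamma>0) * ?\<tau> * ?S
        + real CARD('n) / 2 * (real T / ?\<tau>)"
      using ex_run.\<gamma>0 \<tau>1 by (simp add: field_simps)
    also have "\<dots> = (k0 / (3 * \<gamma>0) + real CARD('n) / 2) * ?h + 4 * R / (3 * \<gamma>0) * ?\<tau> * ?S"
      unfolding \<tau>p T\<tau> by (simp add: algebra_simps)
    finally show "(\<Sum>t=1..T. \<Sum>i\<in>UNIV. run_\<omega>.viol i t) \<le> \<dots>" .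
  qed
  moreover have "k0 / (3 * \<gamma>0) + real CARD('n) / 2 \<ge> 0" "4 * R / (3 * \<gamma>0) \<ge> 0"
    using k0 ex_run.\<gamma>0 ex_run.R_nonneg by auto
  ultimately show "\<exists>k\<ge>0. \<exists>c\<ge>0. \<forall>T\<ge>1. \<exists>\<tau>\<ge>1. \<tau> * real T powr (1 - \<theta>1) \<le> real T powr (1 - \<theta>1 / 2) \<and>
      (\<forall>\<omega>\<in>space M. (\<Sum>t=1..T. \<Sum>i\<in>UNIV. compressed_run.viol m g (x \<omega>) i t)
        \<le> k * real T powr (1 - \<theta>1 / 2) + c * \<tau> * (\<Sum>t=1..T. s t * (\<Sum>j\<in>UNIV. comp_err j t \<omega>)))"
    by blast
qed

lemma slater_net_ccv_bigo:
  assumes "slater X m g"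
  shows "expectation_bigo M (\<lambda>T \<omega>. net_ccv m g (x \<omega>) T) (\<lambda>T. real T powr (1 - \<theta>1))"
proof (rule net_ccv_bigo_aux)
  obtain y \<zeta> where y: "y \<in> X" and \<zeta>: "\<zeta> > 0" "\<And>t i k. t \<ge> 1 \<Longrightarrow> k < m i \<Longrightarrow> g i t y k \<le> - \<zeta>"
    using assms by (auto simp: slater_def)
  define k0 where "k0 = 4 * real CARD('n) * R\<^sup>2
    + (2 * real CARD('n) * G1\<^sup>2 * \<alpha> 1 + 4 * real CARD('n) * R * G1) * (\<alpha>0 / (1 - \<theta>1))"
  have k0: "k0 \<ge> 0"
    using ex_run.\<alpha>(1)[of 1] ex_run.G_nonneg ex_run.R_nonneg \<alpha>0 \<theta> by (auto simp: k0_def)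
  have "(\<Sum>t=1..T. \<Sum>i\<in>UNIV. compressed_run.viol m g (x \<omega>) i t)
      \<le> k0 / (2 * \<gamma>0 * \<zeta>) * real T powr (1 - \<theta>1)
        + 4 * R / (2 * \<gamma>0 * \<zeta>) * 1 * (\<Sum>t=1..T. s t * (\<Sum>j\<in>UNIV. comp_err j t \<omega>))"
    if T: "T \<ge> 1" and \<omega>: "\<omega> \<in> space M" for T \<omega>
  proof -
    interpret run_\<omega>: compressed_run X m df g dg E W B \<alpha> \<gamma> s z1 "\<lambda>j t u. Comp u (\<xi> j t \<omega>)"
      "zh \<omega>" "z \<omega>" "x \<omega>" "om \<omega>" "v \<omega>" R G1 G2 L w \<gamma>0
      by (rule pathwise[OF \<omega>])
    let ?S = "\<Sum>t=1..T. s t * (\<Sum>j\<in>UNIV. comp_err j t \<omega>)"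
    have "(\<Sum>t=1..T. \<Sum>i\<in>UNIV. run_\<omega>.viol i t) \<le> 1 / (2 * \<gamma>0 * \<zeta>) *
        (4 * real CARD('n) * R\<^sup>2 + 4 * R * ?S
          + (2 * real CARD('n) * G1\<^sup>2 * \<alpha> 1 + 4 * real CARD('n) * R * G1) * (\<Sum>t=1..T. \<alpha> t))"
      using run_\<omega>.slater_sum_viol_le[OF y \<zeta>] by (simp add: comp_err_def)
    also have "\<dots> \<le> 1 / (2 * \<gamma>0 * \<zeta>) * (k0 * real T powr (1 - \<theta>1) + 4 * R * ?S)"
      unfolding k0_def using energy_bound_le[OF T \<omega>] ex_run.\<gamma>0 \<zeta>
      by (intro mult_left_mono) auto
    finally show ?thesis
      using ex_run.\<gamma>0 \<zeta> by (simp add: add_divide_distrib)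
  qed
  moreover have "k0 / (2 * \<gamma>0 * \<zeta>) \<ge> 0" "4 * R / (2 * \<gamma>0 * \<zeta>) \<ge> 0"
    using k0 ex_run.\<gamma>0 \<zeta> ex_run.R_nonneg by auto
  moreover have "(1::real) \<ge> 1" "1 * real T powr (1 - \<theta>1) \<le> real T powr (1 - \<theta>1)" for T
    by auto
  ultimately show "\<exists>k\<ge>0. \<exists>c\<ge>0. \<forall>T\<ge>1. \<exists>\<tau>\<ge>1. \<tau> * real T powr (1 - \<theta>1) \<le> real T powr (1 - \<theta>1) \<and>
      (\<forall>\<omega>\<in>space M. (\<Sum>t=1..T. \<Sum>i\<in>UNIV. compressed_run.viol m g (x \<omega>) i t)
        \<le> k * real T powr (1 - \<theta>1) + c * \<tau> * (\<Sum>t=1..T. s t * (\<Sum>j\<in>UNIV. comp_err j t \<omega>)))"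
    by blast
qed

end

theorem theorem1:
  fixes X :: "(real ^ 'p) set"
    and m :: "'n::finite \<Rightarrow> nat"
    and f :: "'n \<Rightarrow> nat \<Rightarrow> real ^ 'p \<Rightarrow> real"
    and df :: "'n \<Rightarrow> nat \<Rightarrow> real ^ 'p \<Rightarrow> real ^ 'p"
    and g :: "'n \<Rightarrow> nat \<Rightarrow> real ^ 'p \<Rightarrow> nat \<Rightarrow> real"
    and dg :: "'n \<Rightarrow> nat \<Rightarrow> real ^ 'p \<Rightarrow> nat \<Rightarrow> real ^ 'p"
    and E :: "nat \<Rightarrow> ('n \<times> 'n) set"
    and W :: "nat \<Rightarrow> real ^ 'n ^ 'n"
    and B :: nat
    and M :: "'w measure" and Q :: "'r measure"
    and \<xi> :: "'n \<Rightarrow> nat \<Rightarrow> 'w \<Rightarrow> 'r"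
    and Comp :: "real ^ 'p \<Rightarrow> 'r \<Rightarrow> real ^ 'p"
    and \<alpha> \<gamma> s :: "nat \<Rightarrow> real"
    and z1 :: "'n \<Rightarrow> real ^ 'p"
    and zh z x om :: "'w \<Rightarrow> 'n \<Rightarrow> nat \<Rightarrow> real ^ 'p"
    and v :: "'w \<Rightarrow> 'n \<Rightarrow> nat \<Rightarrow> nat \<Rightarrow> real"
    and R G1 G2 L w d C \<alpha>0 \<gamma>0 s0 \<theta>1 \<theta>2 :: real
  assumes X: "convex X" "closed X" "\<And>y. y \<in> X \<Longrightarrow> norm y \<le> R"
    and feasible: "\<And>T. T \<ge> 1 \<Longrightarrow> feasible_set X m g T \<noteq> {}"
    and g_convex: "\<And>i t k. t \<ge> 1 \<Longrightarrow> k < m i \<Longrightarrow> convex_on X (\<lambda>y. g i t y k)"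
    and f_subgradient: "\<And>i t y. t \<ge> 1 \<Longrightarrow> y \<in> X \<Longrightarrow>
          frechet_subgradient_on X (f i t) y (df i t y)"
    and g_subgradient: "\<And>i t k y. t \<ge> 1 \<Longrightarrow> k < m i \<Longrightarrow> y \<in> X \<Longrightarrow>
          subgradient_on X (\<lambda>u. g i t u k) y (dg i t y k)"
    and g_measurable: "\<And>i t k. t \<ge> 1 \<Longrightarrow> k < m i \<Longrightarrow>
          (\<lambda>y. dg i t y k) \<in> borel_measurable (restrict_space borel X)"
    and f_bound: "\<And>i t y. t \<ge> 1 \<Longrightarrow> y \<in> X \<Longrightarrow> norm (df i t y) \<le> G1"
    and g_bound: "\<And>i t y. t \<ge> 1 \<Longrightarrow> y \<in> X \<Longrightarrow> row_onorm (m i) (dg i t y) \<le> G2"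
    and f_Lipschitz: "\<And>i t y y'. t \<ge> 1 \<Longrightarrow> y \<in> X \<Longrightarrow> y' \<in> X \<Longrightarrow>
          norm (df i t y - df i t y') \<le> L * norm (y - y')"
    and w: "0 < w" "w < 1"
    and W_edge: "\<And>t i j. t \<ge> 1 \<Longrightarrow> (j, i) \<in> E t \<or> i = j \<Longrightarrow> W t $ i $ j \<ge> w"
    and W_nonedge: "\<And>t i j. t \<ge> 1 \<Longrightarrow> \<not> ((j, i) \<in> E t \<or> i = j) \<Longrightarrow> W t $ i $ j = 0"
    and W_stochastic: "\<And>t. t \<ge> 1 \<Longrightarrow> doubly_stochastic (W t)"
    and B: "B > 0" "\<And>t. t \<ge> 1 \<Longrightarrow> strongly_connected (\<Union>l\<in>{0..B - 1}. E (t + l))"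
    and prob: "prob_space M" "prob_space Q"
    and \<xi>: "fresh_randomness M Q \<xi>"
    and Comp_measurable: "case_prod Comp \<in> borel_measurable (borel \<Otimes>\<^sub>M Q)"
    and d: "d \<ge> 1"
    and C: "C \<ge> 0"
      "\<And>u. (\<integral>\<^sup>+ r. ennreal ((lp_norm d (Comp u r - u))\<^sup>2) \<partial>Q) \<le> ennreal C"
    and \<theta>1: "0 < \<theta>1" "\<theta>1 < 1" and \<theta>2: "\<theta>1 < \<theta>2"
    and \<alpha>0: "\<alpha>0 > 0" and s0: "s0 > 0"
    and \<gamma>0: "0 < \<gamma>0" "\<gamma>0 \<le> 1 / (4 * G2\<^sup>2)"
    and \<alpha>: "\<And>t. t \<ge> 1 \<Longrightarrow> \<alpha> t = \<alpha>0 / real t powr \<theta>1"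
    and \<gamma>: "\<And>t. t \<ge> 1 \<Longrightarrow> \<gamma> t = \<gamma>0 / \<alpha> t"
    and s: "\<And>t. t \<ge> 1 \<Longrightarrow> s t = s0 / real t powr \<theta>2"
    and z1: "\<And>i. z1 i \<in> X"
    and run: "\<And>\<omega>. \<omega> \<in> space M \<Longrightarrow>
          algorithm_run X m df g dg W \<alpha> \<gamma> s z1 (\<lambda>j t u. Comp u (\<xi> j t \<omega>))
            (zh \<omega>) (z \<omega>) (x \<omega>) (v \<omega>) (om \<omega>)"
  shows "(\<theta>2 < 1 \<longrightarrow> expectation_bigo M (\<lambda>T \<omega>. net_reg X m df g (x \<omega>) T)
            (\<lambda>T. real T powr max (1 - \<theta>1) (1 + \<theta>1 - \<theta>2)))
       \<and> (\<theta>2 \<ge> 1 \<longrightarrow> expectation_bigo M (\<lambda>T \<omega>. net_reg X m df g (x \<omega>) T)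
            (\<lambda>T. real T powr max (1 - \<theta>1) \<theta>1))
       \<and> expectation_bigo M (\<lambda>T \<omega>. net_ccv m g (x \<omega>) T) (\<lambda>T. real T powr (1 - \<theta>1 / 2))
       \<and> (slater X m g \<longrightarrow>
            expectation_bigo M (\<lambda>T \<omega>. net_ccv m g (x \<omega>) T) (\<lambda>T. real T powr (1 - \<theta>1)))"
proof -
  \<comment> \<open>The squared dimension comes from \<open>norm_le_lp_norm\<close> and passes from
    the norm of the hypothesis to the Euclidean one.\<close>
  define C' where "C' = (real CARD('p))\<^sup>2 * C"
  have norm_bound: "(\<integral>\<^sup>+ r. ennreal ((norm (Comp u r - u))\<^sup>2) \<partial>Q) \<le> ennreal C'" for u
  proof -
    let ?p = "(real CARD('p))\<^sup>2"
    have [measurable]: "Comp u \<in> borel_measurable Q"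
      using measurable_compose[OF measurable_Pair1' Comp_measurable, of u] by simp
    have "(norm (Comp u r - u))\<^sup>2 / ?p \<le> (lp_norm d (Comp u r - u))\<^sup>2" for r
      using power_mono[OF norm_le_lp_norm[OF d, of "Comp u r - u"], of 2]
      by (simp add: power_mult_distrib pos_divide_le_eq mult.commute)
    then have "(\<integral>\<^sup>+ r. ennreal ((norm (Comp u r - u))\<^sup>2 / ?p) \<partial>Q) \<le> ennreal C"
      by (intro order_trans[OF nn_integral_mono C(2)[of u]] ennreal_leI)
    then have "ennreal ?p * (\<integral>\<^sup>+ r. ennreal ((norm (Comp u r - u))\<^sup>2 / ?p) \<partial>Q) \<le> ennreal ?p * ennreal C"
      by (rule mult_left_mono) simp
    then show ?thesis
      using C(1) by (subst (asm) nn_integral_cmult[symmetric])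
        (simp_all add: C'_def flip: ennreal_mult)
  qed
  have \<alpha>_decreasing: "\<alpha> (Suc t) \<le> \<alpha> t" if "t \<ge> 1" for t
    using that \<alpha>0 \<theta>1 by (auto simp: \<alpha> intro!: divide_left_mono powr_mono2)
  have \<gamma>0_le: "4 * G2\<^sup>2 * \<gamma>0 \<le> 1"
    using \<gamma>0 by (cases "G2 = 0") (simp_all add: field_simps)
  have "compressed_run X m df g dg E W B \<alpha> \<gamma> s z1 (\<lambda>j t u. Comp u (\<xi> j t \<omega>))
      (zh \<omega>) (z \<omega>) (x \<omega>) (om \<omega>) (v \<omega>) R G1 G2 L w \<gamma>0" if "\<omega> \<in> space M" for \<omega>
  proof
    show "0 < \<alpha> t" "0 < s t" if "t \<ge> 1" for t
      using that \<alpha>0 s0 by (auto simp: \<alpha> s)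
  qed (fact X g_subgradient f_bound g_bound f_Lipschitz w(1) W_edge W_stochastic B \<gamma>0(1) \<gamma>0_le
      \<alpha>_decreasing \<gamma> z1 run[OF that])+
  then interpret power_schedule M Q X df g dg E W B \<alpha> \<gamma> s z1 \<xi> Comp zh z x om v R G1 G2 L w \<gamma>0 C' m
    \<alpha>0 s0 \<theta>1 \<theta>2
    using prob g_measurable \<xi> Comp_measurable norm_bound C(1) feasible \<theta>1 \<theta>2 \<alpha>0 s0 \<alpha> s
    by (intro power_schedule.intro random_run.intro random_run_axioms.intro power_schedule_axioms.intro)
      (auto simp: C'_def)
  \<comment> \<open>Here \<open>1 - \<beta>\<close> is written out; the two rates of the theorem are
    the values of the \<open>min\<close> for \<open>\<theta>2\<close> below 1 and from 1 on.\<close>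
  have regret: "expectation_bigo M (\<lambda>T \<omega>. net_reg X m df g (x \<omega>) T)
      (\<lambda>T. real T powr max (1 - \<theta>1) (1 + \<theta>1 - min \<theta>2 1))"
    using net_reg_bigo by (simp add: algebra_simps)
  show ?thesis
    using regret net_ccv_bigo slater_net_ccv_bigo by (auto simp: min_absorb1 min_absorb2)
qed

end
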